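(* Let $\mathbb F$ be an algebraically closed field of characteristic $p>0$, let $m,n,t\ge 1$, and let $\lambda=(\lambda_1,\dots,\lambda_m)\in(\mathbb F^\times)^m$, $\kappa=(\kappa_1,\dots,\kappa_n)\in(\mathbb F^\times)^n$. The twisted Heisenberg Lie superalgebra $\mathfrak h^{\lambda,\kappa}_{m,n,t}$ is restricted (i.e. it admits a $[p]$-operator on its even part making it a restricted Lie superalgebra) if and only if $p>2$ and $$\lambda_1^{p-1}=\cdots=\lambda_m^{p-1}=\kappa_1^{p-1}=\cdots=\kappa_n^{p-1}.$$
   Context: The twisted Heisenberg Lie superalgebra $\mathfrak h^{\lambda,\kappa}_{m,n,t}$ is the superspace over $\mathbb F$ of superdimension $(2m+2,2n+t)$ with even basis $e_1,\dots,e_{2m+2}$ and odd basis $\omega_1,\dots,\omega_{2n},\eta_1,\dots,\eta_t$, whose non-vanishing brackets (up to super-skew-symmetry) are $$[e_i,e_{m+i}]=[\omega_j,\omega_j]=-[\omega_{n+j},\omega_{n+j}]=[\eta_k,\eta_k]=e_{2m+1},$$ $$[e_{2m+2},e_i]=\lambda_i e_{m+i},\quad [e_{2m+2},e_{m+i}]=\lambda_i e_i,\quad [e_{2m+2},\omega_j]=\kappa_j\omega_{n+j},\quad [e_{2m+2},\omega_{n+j}]=\kappa_j\omega_j,$$ for $1\le i\le m$, $1\le j\le n$, $1\le k\le t$. A restricted Lie algebra over a field $\mathbb F$ of characteristic $p>0$ is a Lie algebra $\mathfrak g$ with a map $[p]:\mathfrak g\to\mathfrak g$, $g\mapsto g^{[p]}$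 (a $[p]$-operator), such that for all $a\in\mathbb F$, $g,h\in\mathfrak g$: (1) $(ag)^{[p]}=a^pg^{[p]}$; (2) $(g+h)^{[p]}=g^{[p]}+h^{[p]}+\sum_{i=1}^{p-1}s_i(g,h)$, where $i\,s_i(g,h)$ is the coefficient of $t^{i-1}$ in $(\mathrm{ad}(tg+h))^{p-1}(g)$; (3) $(\mathrm{ad}\,g)^p=\mathrm{ad}\,g^{[p]}$. A module $M$ over a restricted Lie algebra $(\mathfrak g,[p])$ is restricted if $g\cdots g\cdot m$ ($p$ factors $g$) equals $g^{[p]}\cdot m$ for all $g\in\mathfrak g$, $m\in M$. A restricted Lie superalgebra is a Lie superalgebra $\mathfrak g=\mathfrak g_{\bar 0}\oplus\mathfrak g_{\bar 1}$ with a map $[p]:\mathfrak g_{\bar0}\to\mathfrak g_{\bar0}$ such that $(\mathfrak g_{\bar0},[p])$ is a restricted Lie algebra and $\mathfrak g_{\bar1}$ is a restricted $\mathfrak g_{\bar0}$-module via the bracket. *)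

theory Defs
  imports
    "HOL-Computational_Algebra.Computational_Algebra"
    "HOL-Library.Function_Algebras"
    "HOL-Library.Z2"
begin

section \<open>Restricted Lie algebras and restricted Lie superalgebras\<close>

text \<open>
  Algebras and modules are subspaces of an ambient vector space. Bilinearity of a map on
  \<open>A \<times> B\<close> with values in the vector space containing \<open>B\<close>:
\<close>

definition bilinear_on ::
  "('f::field \<Rightarrow> 'v::ab_group_add \<Rightarrow> 'v) \<Rightarrow> ('f \<Rightarrow> 'w::ab_group_add \<Rightarrow> 'w) \<Rightarrow>
   'v set \<Rightarrow> 'w set \<Rightarrow> ('v \<Rightarrow> 'w \<Rightarrow> 'w) \<Rightarrow> bool" where
  "bilinear_on scale scale' A B f \<longleftrightarrow>
     (\<forall>x\<in>A. \<forall>x'\<in>A. \<forall>y\<in>B. f (x + x') y = f x y + f x' y) \<and>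
     (\<forall>c. \<forall>x\<in>A. \<forall>y\<in>B. f (scale c x) y = scale' c (f x y)) \<and>
     (\<forall>x\<in>A. \<forall>y\<in>B. \<forall>y'\<in>B. f x (y + y') = f x y + f x y') \<and>
     (\<forall>c. \<forall>x\<in>A. \<forall>y\<in>B. f x (scale' c y) = scale' c (f x y))"

locale lie_algebra = vector_space scale
  for scale :: "'f::field \<Rightarrow> 'v::ab_group_add \<Rightarrow> 'v" +
  fixes L :: "'v set" and br :: "'v \<Rightarrow> 'v \<Rightarrow> 'v"
  assumes subspace_L: "subspace L"
    and br_closed: "x \<in> L \<Longrightarrow> y \<in> L \<Longrightarrow> br x y \<in> L"
    and br_bilinear: "bilinear_on scale scale L L br"
    and br_self: "x \<in> L \<Longrightarrow> br x x = 0"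
    and jacobi: "x \<in> L \<Longrightarrow> y \<in> L \<Longrightarrow> z \<in> L \<Longrightarrow>
      br x (br y z) + br y (br z x) + br z (br x y) = 0"

text \<open>
  \<^term>\<open>ad_poly br g h\<close> is \<open>ad (T g + h)\<close> acting on \<open>L \<otimes> \<bbbF>[T]\<close>, whose elements are the
  polynomials in \<open>T\<close> with coefficients in \<open>L\<close>.
\<close>

definition ad_poly ::
  "('v::ab_group_add \<Rightarrow> 'v \<Rightarrow> 'v) \<Rightarrow> 'v \<Rightarrow> 'v \<Rightarrow> 'v poly \<Rightarrow> 'v poly" where
  "ad_poly br g h P = pCons 0 (map_poly (br g) P) + map_poly (br h) P"

definition jacobson_s ::
  "('f::field \<Rightarrow> 'v::ab_group_add \<Rightarrow> 'v) \<Rightarrow> ('v \<Rightarrow> 'v \<Rightarrow> 'v) \<Rightarrow> nat \<Rightarrow> 'v \<Rightarrow> 'v \<Rightarrow> 'v" where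
  "jacobson_s scale br i g h =
     scale (inverse (of_nat i)) (coeff ((ad_poly br g h ^^ (CHAR('f) - 1)) [:g:]) (i - 1))"

locale restricted_lie_algebra = lie_algebra scale L br
  for scale :: "'f::field \<Rightarrow> 'v::ab_group_add \<Rightarrow> 'v" and L :: "'v set" and br +
  fixes pmap :: "'v \<Rightarrow> 'v"
  assumes char_pos: "CHAR('f) > 0"
    and pmap_closed: "g \<in> L \<Longrightarrow> pmap g \<in> L"
    and pmap_scale: "g \<in> L \<Longrightarrow> pmap (scale a g) = scale (a ^ CHAR('f)) (pmap g)"
    and pmap_add: "g \<in> L \<Longrightarrow> h \<in> L \<Longrightarrow>
      pmap (g + h) = pmap g + pmap h + (\<Sum>i = 1..CHAR('f) - 1. jacobson_s scale br i g h)"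
    and ad_pmap: "g \<in> L \<Longrightarrow> x \<in> L \<Longrightarrow> (br g ^^ CHAR('f)) x = br (pmap g) x"

locale lie_module = lie_algebra scale L br + M: vector_space scaleM
  for scale :: "'f::field \<Rightarrow> 'v::ab_group_add \<Rightarrow> 'v" and L :: "'v set" and br
    and scaleM :: "'f \<Rightarrow> 'w::ab_group_add \<Rightarrow> 'w" +
  fixes M :: "'w set" and act :: "'v \<Rightarrow> 'w \<Rightarrow> 'w"
  assumes subspace_M: "M.subspace M"
    and act_closed: "g \<in> L \<Longrightarrow> v \<in> M \<Longrightarrow> act g v \<in> M"
    and act_bilinear: "bilinear_on scale scaleM L M act"
    and act_br: "g \<in> L \<Longrightarrow> h \<in> L \<Longrightarrow> v \<in> M \<Longrightarrow>
      act (br g h) v = act g (act h v) - act h (act g v)"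

locale restricted_lie_module =
  restricted_lie_algebra scale L br pmap + lie_module scale L br scaleM M act
  for scale :: "'f::field \<Rightarrow> 'v::ab_group_add \<Rightarrow> 'v" and L :: "'v set" and br and pmap
    and scaleM :: "'f \<Rightarrow> 'w::ab_group_add \<Rightarrow> 'w" and M :: "'w set" and act +
  assumes act_pmap: "g \<in> L \<Longrightarrow> v \<in> M \<Longrightarrow> (act g ^^ CHAR('f)) v = act (pmap g) v"

text \<open>
  The grading is indexed by \<open>\<int>/2\<close>, realised as the type \<^typ>\<open>bit\<close>. The axioms \<open>even_br_self\<close>
  and \<open>odd_br_br_self\<close> follow from the other ones unless the characteristic is 2, respectively
  3; in these characteristics they are the customary extra conditions, the first of which makes
  the even part a Lie algebra.
\<close>

definition super_sign :: "bit \<Rightarrow> bit \<Rightarrow> 'f::field" where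
  "super_sign a b = (if a = 1 \<and> b = 1 then - 1 else 1)"

locale lie_superalgebra = vector_space scale
  for scale :: "'f::field \<Rightarrow> 'v::ab_group_add \<Rightarrow> 'v" +
  fixes G :: "bit \<Rightarrow> 'v set" and br :: "'v \<Rightarrow> 'v \<Rightarrow> 'v"
  assumes subspace_G: "subspace (G a)"
    and G_direct: "G 0 \<inter> G 1 = {0}"
    and super_br_closed: "x \<in> G a \<Longrightarrow> y \<in> G b \<Longrightarrow> br x y \<in> G (a + b)"
    and super_br_bilinear:
      "bilinear_on scale scale {x + y |x y. x \<in> G 0 \<and> y \<in> G 1} {x + y |x y. x \<in> G 0 \<and> y \<in> G 1} br"
    and super_skew: "x \<in> G a \<Longrightarrow> y \<in> G b \<Longrightarrow> br x y = - scale (super_sign a b) (br y x)"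
    and super_jacobi: "x \<in> G a \<Longrightarrow> y \<in> G b \<Longrightarrow> z \<in> G c \<Longrightarrow>
      br x (br y z) = br (br x y) z + scale (super_sign a b) (br y (br x z))"
    and even_br_self: "x \<in> G 0 \<Longrightarrow> br x x = 0"
    and odd_br_br_self: "x \<in> G 1 \<Longrightarrow> br x (br x x) = 0"

locale restricted_lie_superalgebra =
  lie_superalgebra scale G br +
  even: restricted_lie_algebra scale "G 0" br pmap +
  odd: restricted_lie_module scale "G 0" br pmap scale "G 1" br
  for scale :: "'f::field \<Rightarrow> 'v::ab_group_add \<Rightarrow> 'v" and G :: "bit \<Rightarrow> 'v set" and br and pmap

definition admits_restriction ::
  "('f::field \<Rightarrow> 'v::ab_group_add \<Rightarrow> 'v) \<Rightarrow> (bit \<Rightarrow> 'v set) \<Rightarrow> ('v \<Rightarrow> 'v \<Rightarrow> 'v) \<Rightarrow> bool" where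
  "admits_restriction scale G br \<longleftrightarrow> (\<exists>pmap. restricted_lie_superalgebra scale G br pmap)"


section \<open>The twisted Heisenberg Lie superalgebra\<close>

datatype th_index = Ev nat | Om nat | Et nat

text \<open>
  \<open>Ev i\<close>, \<open>Om j\<close>, \<open>Et k\<close> index \<open>e\<^sub>i\<close>, \<open>\<omega>\<^sub>j\<close>, \<open>\<eta>\<^sub>k\<close>. A vector is its family of
  coordinates; those of the superalgebra vanish outside the index set for \<open>m, n, t\<close>.
\<close>

definition th_indices :: "nat \<Rightarrow> nat \<Rightarrow> nat \<Rightarrow> bit \<Rightarrow> th_index set" where
  "th_indices m n t a = (if a = 0 then Ev ` {1..2*m+2} else Om ` {1..2*n} \<union> Et ` {1..t})"

definition th_scale :: "'f::field \<Rightarrow> (th_index \<Rightarrow> 'f) \<Rightarrow> (th_index \<Rightarrow> 'f)" where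
  "th_scale c x = (\<lambda>b. c * x b)"

definition th_space :: "nat \<Rightarrow> nat \<Rightarrow> nat \<Rightarrow> bit \<Rightarrow> (th_index \<Rightarrow> 'f::field) set" where
  "th_space m n t a = {x. \<forall>b. b \<notin> th_indices m n t a \<longrightarrow> x b = 0}"

definition th_unit :: "th_index \<Rightarrow> (th_index \<Rightarrow> 'f::field)" where
  "th_unit b = (\<lambda>c. if c = b then 1 else 0)"

text \<open>Brackets of basis vectors; only meaningful on indices in \<^const>\<open>th_indices\<close>.\<close>

fun th_basis_br ::
  "nat \<Rightarrow> nat \<Rightarrow> (nat \<Rightarrow> 'f::field) \<Rightarrow> (nat \<Rightarrow> 'f) \<Rightarrow> th_index \<Rightarrow> th_index \<Rightarrow> (th_index \<Rightarrow> 'f)" where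
  "th_basis_br m n lam kap (Ev i) (Ev j) =
    (if i \<in> {1..m} \<and> j = m + i then th_unit (Ev (2*m+1))
     else if j \<in> {1..m} \<and> i = m + j then - th_unit (Ev (2*m+1))
     else if i = 2*m+2 \<and> j \<in> {1..m} then th_scale (lam j) (th_unit (Ev (m + j)))
     else if i = 2*m+2 \<and> j \<in> {m+1..2*m} then th_scale (lam (j - m)) (th_unit (Ev (j - m)))
     else if j = 2*m+2 \<and> i \<in> {1..m} then - th_scale (lam i) (th_unit (Ev (m + i)))
     else if j = 2*m+2 \<and> i \<in> {m+1..2*m} then - th_scale (lam (i - m)) (th_unit (Ev (i - m)))
     else 0)"
| "th_basis_br m n lam kap (Ev i) (Om j) =
    (if i = 2*m+2 \<and> j \<in> {1..n} then th_scale (kap j) (th_unit (Om (n + j)))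
     else if i = 2*m+2 \<and> j \<in> {n+1..2*n} then th_scale (kap (j - n)) (th_unit (Om (j - n)))
     else 0)"
| "th_basis_br m n lam kap (Om j) (Ev i) =
    (if i = 2*m+2 \<and> j \<in> {1..n} then - th_scale (kap j) (th_unit (Om (n + j)))
     else if i = 2*m+2 \<and> j \<in> {n+1..2*n} then - th_scale (kap (j - n)) (th_unit (Om (j - n)))
     else 0)"
| "th_basis_br m n lam kap (Om i) (Om j) =
    (if i = j \<and> j \<in> {1..n} then th_unit (Ev (2*m+1))
     else if i = j \<and> j \<in> {n+1..2*n} then - th_unit (Ev (2*m+1))
     else 0)"
| "th_basis_br m n lam kap (Et i) (Et j) = (if i = j then th_unit (Ev (2*m+1)) else 0)"
| "th_basis_br m n lam kap (Ev i) (Et j) = 0"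
| "th_basis_br m n lam kap (Et i) (Ev j) = 0"
| "th_basis_br m n lam kap (Om i) (Et j) = 0"
| "th_basis_br m n lam kap (Et i) (Om j) = 0"

definition th_br ::
  "nat \<Rightarrow> nat \<Rightarrow> nat \<Rightarrow> (nat \<Rightarrow> 'f::field) \<Rightarrow> (nat \<Rightarrow> 'f) \<Rightarrow>
   (th_index \<Rightarrow> 'f) \<Rightarrow> (th_index \<Rightarrow> 'f) \<Rightarrow> (th_index \<Rightarrow> 'f)" where
  "th_br m n t lam kap x y =
    (\<Sum>b \<in> th_indices m n t 0 \<union> th_indices m n t 1. \<Sum>c \<in> th_indices m n t 0 \<union> th_indices m n t 1.
       th_scale (x b * y c) (th_basis_br m n lam kap b c))"

end

theory Submission
  imports Defs
begin

text \<open>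
  Write \<open>d = e\<^sub>2\<^sub>m\<^sub>+\<^sub>2\<close> and \<open>z = e\<^sub>2\<^sub>m\<^sub>+\<^sub>1\<close>. The square of \<open>ad d\<close> acts on the plane of \<open>e\<^sub>i, e\<^sub>m\<^sub>+\<^sub>i\<close> as the
  scalar \<open>\<lambda>\<^sub>i\<^sup>2\<close> and on that of \<open>\<omega>\<^sub>j, \<omega>\<^sub>n\<^sub>+\<^sub>j\<close> as \<open>\<kappa>\<^sub>j\<^sup>2\<close>, while \<open>ad d\<close> swaps the two basis vectors. If
  \<open>p = 2\<close>, then \<open>(ad d)\<^sup>p\<close> preserves the lines they span whereas \<open>ad d\<^bsup>[p]\<^esup>\<close> moves them; if \<open>p\<close> is odd, the two
  agree only if all \<open>\<lambda>\<^sub>i\<^sup>p\<^sup>-\<^sup>1\<close> and \<open>\<kappa>\<^sub>j\<^sup>p\<^sup>-\<^sup>1\<close> equal the \<open>d\<close>-coordinate \<open>c\<close> of \<open>d\<^bsup>[p]\<^esup>\<close>.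

  Conversely, for \<open>x = a d + v + b z\<close> with \<open>v\<close> in the span of \<open>e\<^sub>1, \<dots>, e\<^sub>2\<^sub>m\<close>, the map
  \<open>x\<^bsup>[p]\<^esup> = c a\<^sup>p\<^sup>-\<^sup>1 (a d + v) + (a\<^sup>p\<^sup>-\<^sup>2 Q(v) / 2) z\<close>, with \<open>Q(v) = \<Sum>\<^sub>i \<lambda>\<^sub>i\<^sup>p\<^sup>-\<^sup>2 (v\<^sub>i\<^sup>2 - v\<^sub>m\<^sub>+\<^sub>i\<^sup>2)\<close>, works:
  over \<open>\<bbbF>[T]\<close> the element \<open>(ad (T g + h))\<^sup>p\<^sup>-\<^sup>1 g\<close> is the derivative of \<open>(T g + h)\<^bsup>[p]\<^esup>\<close>, a polynomial of
  degree at most \<open>p\<close> with constant term \<open>h\<^bsup>[p]\<^esup>\<close> and \<open>T\<^sup>p\<close>-coefficient \<open>g\<^bsup>[p]\<^esup>\<close>. Its value at \<open>T = 1\<close>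
  gives Jacobson's formula.
\<close>

section \<open>Pointwise sums and top coefficients of products\<close>

lemma sum_fun_apply: "(\<Sum>i\<in>A. f i) b = (\<Sum>i\<in>A. f i b)"
  by (induction A rule: infinite_finite_induct) simp_all

text \<open>In every other term of the convolution one factor lies above its degree bound. This will
  extract \<open>T^p\<close>-coefficients.\<close>

lemma coeff_mult_top:
  fixes P Q :: "'a::comm_semiring_0 poly"
  assumes "degree P \<le> i" "degree Q \<le> j"
  shows "coeff (P * Q) (i + j) = coeff P i * coeff Q j"
proof -
  have "coeff (P * Q) (i + j) = (\<Sum>k\<le>i+j. coeff P k * coeff Q (i + j - k))"
    by (rule coeff_mult)
  also have "\<dots> = (\<Sum>k\<in>{i}. coeff P k * coeff Q (i + j - k))"
  proof (rule sum.mono_neutral_right)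
    show "\<forall>k\<in>{..i + j} - {i}. coeff P k * coeff Q (i + j - k) = 0"
    proof
      fix k assume k: "k \<in> {..i + j} - {i}"
      show "coeff P k * coeff Q (i + j - k) = 0"
      proof (cases "k < i")
        case True
        then show ?thesis using assms(2) by (simp add: coeff_eq_0)
      next
        case False
        then have "i < k" using k by auto
        then show ?thesis using assms(1) by (simp add: coeff_eq_0)
      qed
    qed
  qed auto
  finally show ?thesis by simp
qed


section \<open>The bracket in coordinates\<close>

text \<open>
  \<open>V\<close>, \<open>W\<close>, \<open>H\<close> are the indices of the \<open>e\<^sub>i\<close> with \<open>i \<le> 2m\<close>, of the \<open>\<omega>\<^sub>j\<close> and of the \<open>\<eta>\<^sub>k\<close>; \<open>d\<close> and
  \<open>z\<close> are those of \<open>e\<^sub>2\<^sub>m\<^sub>+\<^sub>2\<close> and \<open>e\<^sub>2\<^sub>m\<^sub>+\<^sub>1\<close>. The involution \<open>\<tau>\<close> exchanges \<open>e\<^sub>i\<close> with \<open>e\<^sub>m\<^sub>+\<^sub>i\<close> and \<open>\<omega>\<^sub>j\<close>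
  with \<open>\<omega>\<^sub>n\<^sub>+\<^sub>j\<close>, \<open>\<epsilon>\<close> is the sign in the brackets with value \<open>\<plusminus>e\<^sub>2\<^sub>m\<^sub>+\<^sub>1\<close>, and \<open>\<mu>\<close> collects \<open>\<lambda>\<close> and
  \<open>\<kappa>\<close>. The scalars form a ring so that \<open>\<bbbF>[T]\<close> is covered, as Jacobson's formula requires.
\<close>

locale twisted_form =
  fixes V W H :: "th_index set" and d z :: th_index and \<tau> :: "th_index \<Rightarrow> th_index"
    and \<epsilon> \<mu> :: "th_index \<Rightarrow> 'r::comm_ring_1"
  assumes finite_VWH: "finite V" "finite W" "finite H"
    and disjoint_VWH: "V \<inter> (W \<union> H) = {}" "W \<inter> H = {}"
    and dz: "d \<notin> V \<union> W \<union> H" "z \<notin> V \<union> W \<union> H" "d \<noteq> z"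
    and swap_V: "b \<in> V \<Longrightarrow> \<tau> b \<in> V"
    and swap_W: "b \<in> W \<Longrightarrow> \<tau> b \<in> W"
    and swap_swap: "b \<in> V \<union> W \<Longrightarrow> \<tau> (\<tau> b) = b"
    and eps_swap: "b \<in> V \<union> W \<Longrightarrow> \<epsilon> (\<tau> b) = - \<epsilon> b"
    and wt_swap: "b \<in> V \<union> W \<Longrightarrow> \<mu> (\<tau> b) = \<mu> b"
    and wt_0: "b \<notin> V \<union> W \<Longrightarrow> \<mu> b = 0"
begin

definition tbr :: "(th_index \<Rightarrow> 'r) \<Rightarrow> (th_index \<Rightarrow> 'r) \<Rightarrow> th_index \<Rightarrow> 'r" where
  "tbr x y b =
     (if b = z then (\<Sum>a\<in>V. \<epsilon> a * x a * y (\<tau> a)) + (\<Sum>a\<in>W \<union> H. \<epsilon> a * x a * y a)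
      else \<mu> b * (x d * y (\<tau> b) - x (\<tau> b) * y d))"

lemma tbr_z: "tbr x y z = (\<Sum>a\<in>V. \<epsilon> a * x a * y (\<tau> a)) + (\<Sum>a\<in>W \<union> H. \<epsilon> a * x a * y a)"
  and tbr_not_z: "b \<noteq> z \<Longrightarrow> tbr x y b = \<mu> b * (x d * y (\<tau> b) - x (\<tau> b) * y d)"
  by (simp_all add: tbr_def)

lemma wt_d: "\<mu> d = 0" and wt_H: "b \<in> H \<Longrightarrow> \<mu> b = 0"
  using wt_0 dz disjoint_VWH by auto

lemma swap_VW: "b \<in> V \<union> W \<Longrightarrow> \<tau> b \<in> V \<union> W"
  using swap_V swap_W by blast

lemma VW_ne: "b \<in> V \<union> W \<Longrightarrow> b \<noteq> d \<and> b \<noteq> z" "b \<in> H \<Longrightarrow> b \<noteq> d \<and> b \<noteq> z"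
  using dz by auto

lemma tbr_d: "tbr x y d = 0"
  using dz by (simp add: tbr_not_z wt_d)

text \<open>The factor \<open>\<mu> b\<close> on both sides makes the identity hold for every
  \<open>b\<close> other than \<open>z\<close>: outside \<open>V \<union> W\<close>, where \<tau> is
  unconstrained, both sides vanish.\<close>

lemma tbr_twice:
  assumes "b \<noteq> z"
  shows "\<mu> b * tbr x y (\<tau> b) = \<mu> b * (\<mu> b * (x d * y b - x b * y d))"
proof (cases "b \<in> V \<union> W")
  case True
  then show ?thesis
    using VW_ne(1)[OF swap_VW[OF True]] by (simp add: tbr_not_z swap_swap wt_swap)
qed (simp add: wt_0)

text \<open>Reindexing by the involution \<tau> reverses the sign \<epsilon>; all skew-symmetry
  below comes from this.\<close>

lemma sum_swap:
  assumes "A = V \<or> A = W"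
  shows "(\<Sum>b\<in>A. \<epsilon> b * f (\<tau> b)) = - (\<Sum>b\<in>A. \<epsilon> b * f b)"
proof -
  have "(\<Sum>b\<in>A. \<epsilon> b * f (\<tau> b)) = (\<Sum>b\<in>A. - \<epsilon> b * f b)"
    using assms by (intro sum.reindex_bij_witness[of _ \<tau> \<tau>])
      (auto simp: swap_V swap_W swap_swap eps_swap)
  then show ?thesis by (simp add: sum_negf)
qed

section \<open>Powers of adjoint maps\<close>

text \<open>Brackets have no \<open>d\<close>-coordinate, so after the first application two further
  ones just multiply coordinate \<open>b\<close> by the square of
  \<open>\<mu> b * x d\<close>.\<close>

lemma
  assumes "b \<noteq> z"
  shows funpow_tbr_odd: "(tbr x ^^ (2*k+1)) y b =
      \<mu> b ^ (2*k+1) * x d ^ (2*k) * (x d * y (\<tau> b) - x (\<tau> b) * y d)" (is ?P)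
    and funpow_tbr_even: "(tbr x ^^ (2*k+2)) y b =
      \<mu> b ^ (2*k+2) * x d ^ (2*k+1) * (x d * y b - x b * y d)" (is ?Q)
proof -
  \<comment> \<open>Quantified over \<open>b\<close> since the induction also uses the coordinate
    \<open>d\<close>, and \<open>?Q\<close> the coordinate \<open>\<tau> b\<close>.\<close>
  have *: "\<forall>b. b \<noteq> z \<longrightarrow> (tbr x ^^ (2*k+1)) y b =
      \<mu> b ^ (2*k+1) * x d ^ (2*k) * (x d * y (\<tau> b) - x (\<tau> b) * y d)" for k
  proof (induction k)
    case (Suc k)
    show ?case
    proof (intro allI impI)
      fix b assume b: "b \<noteq> z"
      let ?u = "(tbr x ^^ (2*k+1)) y"
      have u: "?u b = \<mu> b ^ (2*k+1) * x d ^ (2*k) * (x d * y (\<tau> b) - x (\<tau> b) * y d)" "?u d = 0"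
        using Suc b dz(3) by (auto simp: wt_d)
      have "(tbr x ^^ (2 * Suc k + 1)) y b = tbr x (tbr x ?u) b" by simp
      also have "\<dots> = \<mu> b * tbr x ?u (\<tau> b) * x d"
        using b by (simp add: tbr_not_z tbr_d)
      also have "\<dots> = \<mu> b * (\<mu> b * (x d * ?u b - x b * ?u d)) * x d"
        by (simp only: tbr_twice[OF b])
      also have "\<dots> = \<mu> b ^ (2 * Suc k + 1) * x d ^ (2 * Suc k) * (x d * y (\<tau> b) - x (\<tau> b) * y d)"
        unfolding u by (simp add: algebra_simps)
      finally show "(tbr x ^^ (2 * Suc k + 1)) y b =
        \<mu> b ^ (2 * Suc k + 1) * x d ^ (2 * Suc k) * (x d * y (\<tau> b) - x (\<tau> b) * y d)" .
    qed
  qed (simp add: tbr_not_z)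
  show ?P using * assms by blast
  have "(tbr x ^^ (2*k+2)) y b = \<mu> b * (x d * (tbr x ^^ (2*k+1)) y (\<tau> b) - x (\<tau> b) * (tbr x ^^ (2*k+1)) y d)"
    using assms by (simp add: tbr_not_z)
  also have "\<dots> = \<mu> b * (x d * (tbr x ^^ (2*k+1)) y (\<tau> b))"
    using * dz(3) wt_d by simp
  also have "\<dots> = \<mu> b ^ (2*k+2) * x d ^ (2*k+1) * (x d * y b - x b * y d)"
  proof (cases "b \<in> V \<union> W")
    case True
    then have "\<tau> b \<noteq> z" using VW_ne swap_VW by blast
    then show ?thesis using * True by (simp add: wt_swap swap_swap)
  qed (simp add: wt_0)
  finally show ?Q .
qed

text \<open>The outermost bracket pairs \<open>x\<close> with a lower power, whose coordinates on
  \<open>V\<close> are already known. This even power serves Jacobson's formula; the odd one below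
  serves the \<open>p\<close>-th power of \<open>ad x\<close>.\<close>

lemma funpow_tbr_even_z:
  assumes "\<And>b. b \<in> W \<union> H \<Longrightarrow> x b = 0"
  shows "(tbr x ^^ (2*k+2)) y z =
    (\<Sum>b\<in>V. \<epsilon> b * x b * (\<mu> b ^ (2*k+1) * x d ^ (2*k) * (x d * y b - x b * y d)))"
proof -
  have "(tbr x ^^ (2*k+2)) y z = tbr x ((tbr x ^^ (2*k+1)) y) z" by simp
  also have "\<dots> = (\<Sum>b\<in>V. \<epsilon> b * x b * (tbr x ^^ (2*k+1)) y (\<tau> b))"
    using assms by (simp add: tbr_z)
  also have "\<dots> = (\<Sum>b\<in>V. \<epsilon> b * x b * (\<mu> b ^ (2*k+1) * x d ^ (2*k) * (x d * y b - x b * y d)))"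
  proof (rule sum.cong[OF refl])
    fix b assume "b \<in> V"
    then have "b \<in> V \<union> W" "\<tau> b \<noteq> z" using VW_ne swap_VW by blast+
    then show "\<epsilon> b * x b * (tbr x ^^ (2*k+1)) y (\<tau> b) =
      \<epsilon> b * x b * (\<mu> b ^ (2*k+1) * x d ^ (2*k) * (x d * y b - x b * y d))"
      using funpow_tbr_odd[of "\<tau> b" k x y] by (simp add: wt_swap swap_swap)
  qed
  finally show ?thesis .
qed

lemma funpow_tbr_odd_z:
  assumes "\<And>b. b \<in> W \<union> H \<Longrightarrow> x b = 0"
  shows "(tbr x ^^ (2*k+3)) y z =
    (\<Sum>b\<in>V. \<epsilon> b * x b * (\<mu> b ^ (2*k+2) * x d ^ (2*k+1) * (x d * y (\<tau> b) - x (\<tau> b) * y d)))"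
proof -
  have "(tbr x ^^ (2*k+3)) y z = tbr x ((tbr x ^^ (2*k+2)) y) z"
    by (simp add: eval_nat_numeral)
  also have "\<dots> = (\<Sum>b\<in>V. \<epsilon> b * x b * (tbr x ^^ (2*k+2)) y (\<tau> b))"
    using assms by (simp add: tbr_z)
  also have "\<dots> = (\<Sum>b\<in>V. \<epsilon> b * x b * (\<mu> b ^ (2*k+2) * x d ^ (2*k+1) * (x d * y (\<tau> b) - x (\<tau> b) * y d)))"
  proof (rule sum.cong[OF refl])
    fix b assume "b \<in> V"
    then have "b \<in> V \<union> W" "\<tau> b \<noteq> z" using VW_ne swap_VW by blast+
    then show "\<epsilon> b * x b * (tbr x ^^ (2*k+2)) y (\<tau> b) =
      \<epsilon> b * x b * (\<mu> b ^ (2*k+2) * x d ^ (2*k+1) * (x d * y (\<tau> b) - x (\<tau> b) * y d))"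
      using funpow_tbr_even[of "\<tau> b" k x y] by (simp add: wt_swap)
  qed
  finally show ?thesis .
qed

section \<open>The grading, super-skew-symmetry and the super Jacobi identity\<close>

definition space :: "bit \<Rightarrow> (th_index \<Rightarrow> 'r) set" where
  "space a = {x. \<forall>b. b \<notin> (if a = 0 then V \<union> {d, z} else W \<union> H) \<longrightarrow> x b = 0}"

lemma space_0: "x \<in> space 0 \<longleftrightarrow> (\<forall>b. b \<notin> V \<union> {d, z} \<longrightarrow> x b = 0)"
  and space_1: "x \<in> space 1 \<longleftrightarrow> (\<forall>b. b \<notin> W \<union> H \<longrightarrow> x b = 0)"
  by (simp_all add: space_def)

lemma space_0_odd: "x \<in> space 0 \<Longrightarrow> b \<in> W \<union> H \<Longrightarrow> x b = 0"
  unfolding space_0 using disjoint_VWH dz by blast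

lemma space_1_even: "x \<in> space 1 \<Longrightarrow> b \<in> V \<union> {d, z} \<Longrightarrow> x b = 0"
  unfolding space_1 using disjoint_VWH dz by blast

lemma tbr_closed:
  assumes "x \<in> space a" "y \<in> space b"
  shows "tbr x y \<in> space (a + b)"
proof -
  have x: "a = 0 \<or> a = 1" and y: "b = 0 \<or> b = 1" by (cases a; cases b; simp)+
  consider "a = 0" "b = 0" | "a = 1" "b = 1" | "a = 0" "b = 1" | "a = 1" "b = 0"
    using x y by blast
  then show ?thesis
  proof cases
    case 1
    have "tbr x y e = 0" if "e \<notin> V \<union> {d, z}" for e
    proof (cases "e \<in> W")
      case True
      then have "x (\<tau> e) = 0" "y (\<tau> e) = 0" using assms 1 space_0_odd swap_W by auto
      then show ?thesis using that by (simp add: tbr_not_z)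
    qed (use that in \<open>auto simp: tbr_not_z wt_0\<close>)
    then show ?thesis using 1 by (simp add: space_0)
  next
    case 2
    have "x d = 0" "y d = 0" using assms 2 space_1_even by auto
    then show ?thesis using 2 by (auto simp: space_0 tbr_not_z)
  next
    case 3
    have "tbr x y e = 0" if "e \<notin> W \<union> H" for e
    proof (cases "e = z")
      case True
      have "(\<Sum>a\<in>V. \<epsilon> a * x a * y (\<tau> a)) = 0"
        using space_1_even[of y] assms 3 swap_V by (intro sum.neutral) auto
      moreover have "(\<Sum>a\<in>W \<union> H. \<epsilon> a * x a * y a) = 0"
        using space_0_odd[of x] assms 3 by (intro sum.neutral) auto
      ultimately show ?thesis using True by (simp add: tbr_z)
    next
      case False
      have "y d = 0" "e \<in> V \<Longrightarrow> y (\<tau> e) = 0" using space_1_even[of y] assms 3 swap_V by auto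
      then show ?thesis using False that by (cases "e \<in> V") (auto simp: tbr_not_z wt_0)
    qed
    then show ?thesis using 3 by (simp add: space_1)
  next
    case 4
    have "tbr x y e = 0" if "e \<notin> W \<union> H" for e
    proof (cases "e = z")
      case True
      have "(\<Sum>a\<in>V. \<epsilon> a * x a * y (\<tau> a)) = 0"
        using space_1_even[of x] assms 4 by (intro sum.neutral) auto
      moreover have "(\<Sum>a\<in>W \<union> H. \<epsilon> a * x a * y a) = 0"
        using space_0_odd[of y] assms 4 by (intro sum.neutral) auto
      ultimately show ?thesis using True by (simp add: tbr_z)
    next
      case False
      have "x d = 0" "e \<in> V \<Longrightarrow> x (\<tau> e) = 0" using space_1_even[of x] assms 4 swap_V by auto
      then show ?thesis using False that by (cases "e \<in> V") (auto simp: tbr_not_z wt_0)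
    qed
    then show ?thesis using 4 by (simp add: space_1)
  qed
qed

lemma form_skew: "(\<Sum>a\<in>V. \<epsilon> a * x a * y (\<tau> a)) = - (\<Sum>a\<in>V. \<epsilon> a * y a * x (\<tau> a))"
proof -
  have "(\<Sum>a\<in>V. \<epsilon> a * y a * x (\<tau> a)) = (\<Sum>a\<in>V. \<epsilon> a * (y (\<tau> (\<tau> a)) * x (\<tau> a)))"
    by (rule sum.cong) (auto simp: swap_swap mult.assoc)
  also have "\<dots> = - (\<Sum>a\<in>V. \<epsilon> a * (y (\<tau> a) * x a))"
    by (rule sum_swap) simp
  finally show ?thesis by (simp add: mult_ac)
qed

text \<open>The form giving the \<open>z\<close>-coordinate is skew on \<open>V\<close> and
  symmetric on \<open>W \<union> H\<close>; parity kills whichever part has the wrong sign.\<close>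

lemma tbr_skew:
  assumes "x \<in> space a" "y \<in> space b"
  shows "tbr x y e = - ((if a = 1 \<and> b = 1 then - 1 else 1) * tbr y x e)"
proof (cases "a = 1 \<and> b = 1")
  case True
  then have "x b = 0" "y b = 0" if "b \<in> V \<union> {d, z}" for b
    using assms space_1_even that by auto
  then show ?thesis using True by (simp add: tbr_def mult_ac)
next
  case False
  then have "x b = 0 \<or> y b = 0" if "b \<in> W \<union> H" for b
    using assms space_0_odd that by (cases a; cases b) auto
  then have *: "(\<Sum>a\<in>W \<union> H. \<epsilon> a * x a * y a) = 0" "(\<Sum>a\<in>W \<union> H. \<epsilon> a * y a * x a) = 0"
    by (intro sum.neutral ballI; fastforce)+
  show ?thesis
    using form_skew[of x y] * False by (cases "e = z") (auto simp: tbr_z tbr_not_z algebra_simps)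
qed

text \<open>\<open>quad\<close> and \<open>skew_form\<close> pair \<open>x\<close> with the image of
  \<open>y\<close> under \<open>ad d\<close>, on \<open>V\<close> and on \<open>W\<close>. Inserting
  \<open>ad d\<close> turns the skew form on \<open>V\<close> into a symmetric one and the symmetric
  form on \<open>W\<close> into a skew one.\<close>

definition quad :: "(th_index \<Rightarrow> 'r) \<Rightarrow> (th_index \<Rightarrow> 'r) \<Rightarrow> 'r" where
  "quad x y = (\<Sum>b\<in>V. \<epsilon> b * \<mu> b * x b * y b)"

definition skew_form :: "(th_index \<Rightarrow> 'r) \<Rightarrow> (th_index \<Rightarrow> 'r) \<Rightarrow> 'r" where
  "skew_form x y = (\<Sum>b\<in>W. \<epsilon> b * \<mu> b * x b * y (\<tau> b))"

lemma quad_sym: "quad x y = quad y x"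
  by (simp add: quad_def mult_ac)

lemma skew_form_skew: "skew_form x y = - skew_form y x"
proof -
  have "skew_form x y = (\<Sum>b\<in>W. \<epsilon> b * (\<mu> (\<tau> b) * x (\<tau> (\<tau> b)) * y (\<tau> b)))"
    unfolding skew_form_def by (rule sum.cong) (auto simp: swap_swap wt_swap mult_ac)
  also have "\<dots> = - (\<Sum>b\<in>W. \<epsilon> b * (\<mu> b * x (\<tau> b) * y b))"
    by (rule sum_swap) simp
  finally show ?thesis by (simp add: skew_form_def mult_ac)
qed

lemma tbr_z_right: "tbr x (tbr y w) z =
  y d * quad x w - w d * quad x y + y d * skew_form x w - w d * skew_form x y"
proof -
  have 1: "(\<Sum>b\<in>V. \<epsilon> b * x b * tbr y w (\<tau> b)) = y d * quad x w - w d * quad x y"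
  proof -
    have "(\<Sum>b\<in>V. \<epsilon> b * x b * tbr y w (\<tau> b)) =
      (\<Sum>b\<in>V. y d * (\<epsilon> b * \<mu> b * x b * w b) - w d * (\<epsilon> b * \<mu> b * x b * y b))"
    proof (rule sum.cong[OF refl])
      fix b assume "b \<in> V"
      then have "b \<in> V \<union> W" "\<tau> b \<noteq> z" using VW_ne swap_VW by blast+
      then show "\<epsilon> b * x b * tbr y w (\<tau> b) =
          y d * (\<epsilon> b * \<mu> b * x b * w b) - w d * (\<epsilon> b * \<mu> b * x b * y b)"
        by (simp add: tbr_not_z wt_swap swap_swap algebra_simps)
    qed
    then show ?thesis by (simp add: quad_def sum_subtractf sum_distrib_left)
  qed
  have "(\<Sum>b\<in>W \<union> H. \<epsilon> b * x b * tbr y w b) = (\<Sum>b\<in>W. \<epsilon> b * x b * tbr y w b)"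
    using finite_VWH wt_H VW_ne by (intro sum.mono_neutral_right) (auto simp: tbr_not_z)
  also have "\<dots> = (\<Sum>b\<in>W. y d * (\<epsilon> b * \<mu> b * x b * w (\<tau> b)) - w d * (\<epsilon> b * \<mu> b * x b * y (\<tau> b)))"
  proof (rule sum.cong[OF refl])
    fix b assume "b \<in> W"
    then have "b \<noteq> z" using VW_ne by blast
    then show "\<epsilon> b * x b * tbr y w b =
        y d * (\<epsilon> b * \<mu> b * x b * w (\<tau> b)) - w d * (\<epsilon> b * \<mu> b * x b * y (\<tau> b))"
      by (simp add: tbr_not_z algebra_simps)
  qed
  finally show ?thesis
    using 1 by (simp add: tbr_z skew_form_def sum_subtractf sum_distrib_left)
qed

lemma tbr_z_left: "tbr (tbr x y) w z =
  y d * quad x w - x d * quad y w + y d * skew_form x w - x d * skew_form y w"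
proof -
  have "(\<Sum>b\<in>V. \<epsilon> b * tbr x y b * w (\<tau> b)) = - (\<Sum>b\<in>V. \<epsilon> b * w b * tbr x y (\<tau> b))"
    by (rule form_skew)
  then have skew: "tbr (tbr x y) w z - (\<Sum>b\<in>W \<union> H. \<epsilon> b * tbr x y b * w b) =
    - (tbr w (tbr x y) z - (\<Sum>b\<in>W \<union> H. \<epsilon> b * w b * tbr x y b))"
    by (simp add: tbr_z)
  have comm: "(\<Sum>b\<in>W \<union> H. \<epsilon> b * w b * tbr x y b) = (\<Sum>b\<in>W \<union> H. \<epsilon> b * tbr x y b * w b)"
    by (simp add: mult_ac)
  have odd: "(\<Sum>b\<in>W \<union> H. \<epsilon> b * tbr x y b * w b) = x d * skew_form w y - y d * skew_form w x"
  proof -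
    have "(\<Sum>b\<in>W \<union> H. \<epsilon> b * tbr x y b * w b) = (\<Sum>b\<in>W. \<epsilon> b * tbr x y b * w b)"
      using finite_VWH wt_H VW_ne by (intro sum.mono_neutral_right) (auto simp: tbr_not_z)
    also have "\<dots> = (\<Sum>b\<in>W. x d * (\<epsilon> b * \<mu> b * w b * y (\<tau> b)) - y d * (\<epsilon> b * \<mu> b * w b * x (\<tau> b)))"
    proof (rule sum.cong[OF refl])
      fix b assume "b \<in> W"
      then have "b \<noteq> z" using VW_ne by blast
      then show "\<epsilon> b * tbr x y b * w b =
        x d * (\<epsilon> b * \<mu> b * w b * y (\<tau> b)) - y d * (\<epsilon> b * \<mu> b * w b * x (\<tau> b))"
        by (simp add: tbr_not_z algebra_simps)
    qed
    finally show ?thesis by (simp add: skew_form_def sum_subtractf sum_distrib_left)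
  qed
  \<comment> \<open>Exchanging the arguments of the outer bracket negates its \<open>V\<close>-part
    and keeps its odd part, so the two orders add up to twice the odd part.\<close>
  have "tbr (tbr x y) w z =
      2 * (x d * skew_form w y - y d * skew_form w x) - tbr w (tbr x y) z"
    using skew[unfolded comm odd] by (simp add: algebra_simps)
  then show ?thesis
    by (simp add: tbr_z_right quad_sym[of w] skew_form_skew[of w] algebra_simps)
qed

text \<open>At \<open>z\<close>, two odd elements have vanishing \<open>quad\<close>, and the
  skewness of \<open>skew_form\<close> matches the super sign; otherwise
  \<open>skew_form x y\<close> vanishes and the symmetry of \<open>quad\<close> suffices. Elsewhere
  \<open>tbr_twice\<close> expands all double brackets.\<close>

lemma tbr_super_jacobi:
  assumes "x \<in> space a" "y \<in> space b"
  shows "tbr x (tbr y w) e =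
    tbr (tbr x y) w e + (if a = 1 \<and> b = 1 then - 1 else 1) * tbr y (tbr x w) e"
proof (cases "e = z")
  case True
  show ?thesis
  proof (cases "a = 1 \<and> b = 1")
    case odd: True
    then have *: "x b = 0" "y b = 0" if "b \<in> V \<union> {d, z}" for b
      using assms space_1_even that by auto
    then have "quad x y = 0" "quad y x = 0" by (auto simp: quad_def)
    then show ?thesis
      using * odd True by (auto simp: tbr_z_left tbr_z_right skew_form_skew[of y x])
  next
    case False
    then have "\<forall>b\<in>W. x b = 0 \<or> y (\<tau> b) = 0"
      using assms space_0_odd[of x] space_0_odd[of y] swap_W by (cases a; cases b) auto
    then have *: "skew_form x y = 0"
      unfolding skew_form_def by (intro sum.neutral) fastforce
    show ?thesis
      using * False True
      by (auto simp: tbr_z_left tbr_z_right quad_sym[of y x] skew_form_skew[of y x] algebra_simps)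
  qed
next
  case e: False
  have *: "x d = 0" "y d = 0" if "a = 1 \<and> b = 1"
    using assms space_1_even that by auto
  have right: "tbr x (tbr y w) e = x d * (\<mu> e * tbr y w (\<tau> e))" for x y w
    using e by (simp add: tbr_not_z[of e x] tbr_d)
  have left: "tbr (tbr x y) w e = - w d * (\<mu> e * tbr x y (\<tau> e))"
    using e by (simp add: tbr_not_z[of e _ w] tbr_d)
  show ?thesis
    unfolding right left tbr_twice[OF e] using * by (auto simp: algebra_simps)
qed

lemma tbr_add_left: "tbr (x + x') y = tbr x y + tbr x' y"
  and tbr_add_right: "tbr x (y + y') = tbr x y + tbr x y'"
  by (rule ext, simp add: tbr_def algebra_simps sum.distrib)+

end

section \<open>The restriction map in odd characteristic\<close>

lemma vector_space_th_scale: "vector_space th_scale"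
  by unfold_locales (auto simp: th_scale_def algebra_simps)

locale twisted_field = twisted_form V W H d z \<tau> \<epsilon> \<mu>
  for V W H :: "th_index set" and d z :: th_index and \<tau> :: "th_index \<Rightarrow> th_index"
    and \<epsilon> \<mu> :: "th_index \<Rightarrow> 'f::field"
begin

sublocale poly: twisted_form V W H d z \<tau> "\<lambda>b. [:\<epsilon> b:]" "\<lambda>b. [:\<mu> b:]"
  by unfold_locales
    (use finite_VWH disjoint_VWH dz in \<open>auto simp: swap_V swap_W swap_swap eps_swap wt_swap wt_0\<close>)

lemma tbr_scale_left: "tbr (th_scale k x) y = th_scale k (tbr x y)"
  and tbr_scale_right: "tbr x (th_scale k y) = th_scale k (tbr x y)"
  by (rule ext, simp add: tbr_def th_scale_def algebra_simps sum_distrib_left)+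

lemma bilinear_tbr: "bilinear_on th_scale th_scale A B tbr"
  by (simp add: bilinear_on_def tbr_add_left tbr_add_right tbr_scale_left tbr_scale_right)

lemma subspace_space: "module.subspace th_scale (space a)"
proof -
  interpret vector_space th_scale by (rule vector_space_th_scale)
  show ?thesis by (auto simp: subspace_def space_def th_scale_def)
qed

end

text \<open>Writing \<open>p\<close> as \<open>2*r+3\<close> makes \<open>p-1\<close>,
  \<open>p-2\<close> and \<open>p-3\<close> the exponents \<open>2*r+2\<close>, \<open>2*r+1\<close>
  and \<open>2*r\<close>, free of truncated subtraction.\<close>

locale twisted_restricted = twisted_field V W H d z \<tau> \<epsilon> \<mu>
  for V W H :: "th_index set" and d z :: th_index and \<tau> :: "th_index \<Rightarrow> th_index"
    and \<epsilon> \<mu> :: "th_index \<Rightarrow> 'f::field" +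
  fixes r :: nat and c :: 'f
  assumes char_odd: "CHAR('f) = 2*r + 3"
    and wt_power: "b \<in> V \<union> W \<Longrightarrow> \<mu> b ^ (2*r+2) = c"
begin

lemma two_neq_0: "(2::'f) \<noteq> 0"
  using of_nat_eq_0_iff_char_dvd[where ?'a='f, of 2] char_odd by (auto dest: dvd_imp_le)

lemma tbr_self:
  assumes "x \<in> space 0"
  shows "tbr x x = 0"
proof
  fix e
  have "tbr x x e = - tbr x x e"
    using tbr_skew[OF assms assms, of e] by simp
  then have "2 * tbr x x e = 0" by (simp add: add_eq_0_iff)
  then show "tbr x x e = 0 e" using two_neq_0 by simp
qed

lemma lie_superalgebra: "lie_superalgebra th_scale space tbr"
proof -
  interpret vector_space th_scale by (rule vector_space_th_scale)
  show ?thesis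
  proof unfold_locales
    show "space 0 \<inter> space 1 = {0}"
    proof (intro equalityI subsetI)
      fix x assume x: "x \<in> space 0 \<inter> space 1"
      have "x b = 0" for b
        using x space_0_odd[of x b] by (cases "b \<in> W \<union> H") (auto simp: space_1)
      then show "x \<in> {0}" by auto
    qed (auto simp: space_def)
  next
    fix x y a b assume "x \<in> space a" "y \<in> space b"
    then show "tbr x y = - th_scale (super_sign a b) (tbr y x)"
      using tbr_skew[of x a y b] by (auto simp: th_scale_def super_sign_def)
  next
    fix x y w a b e assume "x \<in> space a" "y \<in> space b"
    then show "tbr x (tbr y w) = tbr (tbr x y) w + th_scale (super_sign a b) (tbr y (tbr x w))"
      using tbr_super_jacobi[of x a y b w] by (auto simp: th_scale_def super_sign_def)
  next
    fix x y a b assume "x \<in> space a" "y \<in> space b"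
    then show "tbr x y \<in> space (a + b)" by (rule tbr_closed)
  next
    fix x assume x: "x \<in> space 1"
    have x0: "x b = 0" if "b \<in> V \<union> {d, z}" for b
      using space_1_even x that by blast
    \<comment> \<open>The bracket of an odd element with itself is a multiple of the central basis
      vector \<open>z\<close>, which gives the triple-bracket axiom in characteristic 3 as
      well.\<close>
    have x1: "tbr x x b = 0" if "b \<noteq> z" for b
      using that x0 by (simp add: tbr_not_z)
    have "(\<Sum>a\<in>W \<union> H. \<epsilon> a * x a * tbr x x a) = 0"
      using x1 VW_ne by (intro sum.neutral) (metis UnCI UnE mult_zero_right)
    then have "tbr x (tbr x x) e = 0" for e
      using x0 by (cases "e = z") (auto simp: tbr_z tbr_not_z tbr_d)
    then show "tbr x (tbr x x) = 0" by auto
  qed (simp_all add: subspace_space bilinear_tbr tbr_self)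
qed

text \<open>
  For even \<open>x\<close> one has \<open>(ad x)\<^sup>p = c x\<^sub>d\<^sup>p\<^sup>-\<^sup>1 ad x\<close>, which determines \<open>x\<^bsup>[p]\<^esup>\<close> up to its central
  coordinate; Jacobson's formula then forces that coordinate up to a \<open>p\<close>-semilinear term.
\<close>

definition pmap :: "(th_index \<Rightarrow> 'f) \<Rightarrow> th_index \<Rightarrow> 'f" where
  "pmap x b =
     (if b = z then inverse 2 * (x d ^ (2*r+1) * (\<Sum>a\<in>V. \<epsilon> a * \<mu> a ^ (2*r+1) * x a ^ 2))
      else c * (x d ^ (2*r+2) * x b))"

lemma pmap_closed: "x \<in> space 0 \<Longrightarrow> pmap x \<in> space 0"
  by (auto simp: space_0 pmap_def)

lemma pmap_scale: "pmap (th_scale k x) = th_scale (k ^ CHAR('f)) (pmap x)"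
proof
  fix b
  show "pmap (th_scale k x) b = th_scale (k ^ CHAR('f)) (pmap x) b"
  proof (cases "b = z")
    case True
    have "(\<Sum>a\<in>V. \<epsilon> a * \<mu> a ^ (2*r+1) * (k * x a)\<^sup>2) = k\<^sup>2 * (\<Sum>a\<in>V. \<epsilon> a * \<mu> a ^ (2*r+1) * (x a)\<^sup>2)"
      by (simp add: sum_distrib_left power_mult_distrib mult_ac)
    moreover have "k ^ CHAR('f) = k ^ (2*r+1) * k\<^sup>2"
      unfolding power_add[symmetric] char_odd by (simp add: eval_nat_numeral)
    ultimately show ?thesis
      using True by (simp add: pmap_def th_scale_def power_mult_distrib)
  next
    case False
    have "k ^ CHAR('f) = k ^ (2*r+2) * k"
      unfolding char_odd power_Suc2[symmetric] by (simp add: eval_nat_numeral)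
    then show ?thesis
      using False by (simp add: pmap_def th_scale_def power_mult_distrib)
  qed
qed

text \<open>As \<open>p\<close> is odd, the odd closed forms apply, and \<open>wt_power\<close>
  replaces the weight power \<open>p-1\<close> by the common value \<open>c\<close>.\<close>

lemma funpow_char_tbr:
  assumes "x \<in> space 0"
  shows "(tbr x ^^ CHAR('f)) y = tbr (pmap x) y"
proof
  fix e
  have x0: "x b = 0" if "b \<in> W \<union> H" for b using space_0_odd assms that by blast
  have p0: "pmap x b = 0" if "b \<in> W \<union> H" for b
    using space_0_odd pmap_closed assms that by blast
  have pV: "pmap x b = c * (x d ^ (2*r+2) * x b)" if "b \<in> V \<union> W \<union> {d}" for b
    using that dz VW_ne by (auto simp: pmap_def)
  have split: "2*r+3 = 2*(r+1)+1" by simp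
  show "(tbr x ^^ CHAR('f)) y e = tbr (pmap x) y e"
  proof (cases "e = z")
    case True
    \<comment> \<open>\<open>S\<close> pairs \<open>x\<close> with itself in the skew form on
      \<open>V\<close>; it equals its own negative, hence is 0 in odd characteristic.\<close>
    define S where "S = (\<Sum>b\<in>V. \<epsilon> b * (x b * x (\<tau> b)))"
    have "S = (\<Sum>b\<in>V. \<epsilon> b * (x (\<tau> (\<tau> b)) * x (\<tau> b)))"
      unfolding S_def by (rule sum.cong) (auto simp: swap_swap)
    also have "\<dots> = - S"
      unfolding S_def using sum_swap[of V "\<lambda>b. x (\<tau> b) * x b"] by (simp add: mult_ac)
    finally have "2 * S = 0" by (simp add: add_eq_0_iff)
    then have S0: "S = 0" using two_neq_0 by simp
    have "(tbr x ^^ CHAR('f)) y z = (\<Sum>b\<in>V. \<epsilon> b * x b *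
       (\<mu> b ^ (2*r+2) * x d ^ (2*r+1) * (x d * y (\<tau> b) - x (\<tau> b) * y d)))"
      unfolding char_odd using x0 by (rule funpow_tbr_odd_z)
    also have "\<dots> = (\<Sum>b\<in>V. \<epsilon> b * x b * (c * x d ^ (2*r+1) * (x d * y (\<tau> b) - x (\<tau> b) * y d)))"
      by (intro sum.cong) (simp_all only: wt_power UnI1)
    also have "\<dots> = (\<Sum>b\<in>V. \<epsilon> b * (c * (x d ^ (2*r+2) * x b)) * y (\<tau> b))
        - c * x d ^ (2*r+1) * y d * S"
      unfolding S_def sum_distrib_left sum_subtractf[symmetric]
      by (intro sum.cong) (simp_all add: algebra_simps)
    also have "\<dots> = (\<Sum>b\<in>V. \<epsilon> b * pmap x b * y (\<tau> b))"
      unfolding S0 using pV by simp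
    also have "\<dots> = tbr (pmap x) y z" using p0 by (simp add: tbr_z)
    finally show ?thesis using True by simp
  next
    case False
    show ?thesis
    proof (cases "e \<in> V \<union> W")
      case True
      have "(tbr x ^^ CHAR('f)) y e =
        \<mu> e ^ (2*(r+1)+1) * x d ^ (2*(r+1)) * (x d * y (\<tau> e) - x (\<tau> e) * y d)"
        unfolding char_odd split by (rule funpow_tbr_odd[OF False])
      also have "\<mu> e ^ (2*(r+1)+1) = \<mu> e * c"
        using wt_power[OF True] by simp
      also have "\<mu> e * c * x d ^ (2*(r+1)) * (x d * y (\<tau> e) - x (\<tau> e) * y d) =
          \<mu> e * (pmap x d * y (\<tau> e) - pmap x (\<tau> e) * y d)"
        using pV[of "\<tau> e"] pV[of d] swap_VW[OF True] by (simp add: algebra_simps)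
      finally show ?thesis using False by (simp add: tbr_not_z)
    next
      case out: False
      show ?thesis
        unfolding char_odd split funpow_tbr_odd[OF False]
        using False out by (simp add: tbr_not_z wt_0)
    qed
  qed
qed

section \<open>Jacobson's formula by differentiation over the polynomial ring\<close>

text \<open>Elements of \<open>L \<otimes> \<bbbF>[T]\<close> are identified with their families of coordinate polynomials.\<close>

definition coords :: "(th_index \<Rightarrow> 'f) poly \<Rightarrow> th_index \<Rightarrow> 'f poly" where
  "coords P b = map_poly (\<lambda>x. x b) P"

text \<open>The coordinates of \<open>T g + h\<close>.\<close>

definition line :: "(th_index \<Rightarrow> 'f) \<Rightarrow> (th_index \<Rightarrow> 'f) \<Rightarrow> th_index \<Rightarrow> 'f poly" where
  "line g h b = [:h b, g b:]"

lemma coeff_coords: "coeff (coords P b) i = coeff P i b"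
  by (simp add: coords_def coeff_map_poly)

lemma tbr_0_right: "tbr x 0 = 0"
  by (auto simp: tbr_def)

lemma coeff_line_mult:
  "coeff (line g h b * P) i = (case i of 0 \<Rightarrow> 0 | Suc j \<Rightarrow> g b * coeff P j) + h b * coeff P i"
  by (cases i) (simp_all add: line_def)

text \<open>This identifies \<open>ad_poly\<close> with a bracket over the polynomial ring, so that
  the closed forms for powers apply to \<open>line g h\<close>.\<close>

lemma coords_ad_poly: "coords (ad_poly tbr g h P) = poly.tbr (line g h) (coords P)"
proof (intro ext poly_eqI)
  fix b i
  have "coeff (coords (ad_poly tbr g h P) b) i =
    (case i of 0 \<Rightarrow> 0 | Suc j \<Rightarrow> tbr g (coeff P j) b) + tbr h (coeff P i) b"
    by (cases i) (simp_all add: coeff_coords ad_poly_def coeff_map_poly tbr_0_right)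
  also have "\<dots> = coeff (poly.tbr (line g h) (coords P) b) i"
  proof (cases "b = z")
    case True
    have *: "coeff ([:e:] * line g h a * Q) i = e * coeff (line g h a * Q) i" for e a Q
      by (simp add: mult.assoc)
    show ?thesis
      unfolding True poly.tbr_z tbr_z coeff_add coeff_sum * coeff_line_mult coeff_coords
      by (cases i) (simp_all add: sum.distrib algebra_simps)
  next
    case False
    have *: "poly.tbr (line g h) (coords P) b =
      smult (\<mu> b) (line g h d * coords P (\<tau> b) - line g h (\<tau> b) * coords P d)"
      using False by (simp add: poly.tbr_not_z)
    show ?thesis
      unfolding * tbr_not_z[OF False] coeff_smult coeff_diff coeff_line_mult coeff_coords
      by (cases i) (simp_all add: algebra_simps)
  qed
  finally show "coeff (coords (ad_poly tbr g h P) b) i = coeff (poly.tbr (line g h) (coords P) b) i" .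
qed

lemma coords_ad_poly_funpow:
  "coords ((ad_poly tbr g h ^^ N) [:g:]) = (poly.tbr (line g h) ^^ N) (\<lambda>b. [:g b:])"
proof (induction N)
  case 0
  show ?case by (rule ext) (simp add: coords_def map_poly_pCons)
qed (simp add: coords_ad_poly)

text \<open>The coordinates of \<open>(T g + h)\<^bsup>[p]\<^esup>\<close>; their derivatives generate the terms of Jacobson's formula.\<close>

definition pmap_line :: "(th_index \<Rightarrow> 'f) \<Rightarrow> (th_index \<Rightarrow> 'f) \<Rightarrow> th_index \<Rightarrow> 'f poly" where
  "pmap_line g h b =
     (if b = z then smult (inverse 2) (line g h d ^ (2*r+1) *
        (\<Sum>a\<in>V. smult (\<epsilon> a * \<mu> a ^ (2*r+1)) (line g h a ^ 2)))
      else smult c (line g h d ^ (2*r+2) * line g h b))"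

lemma poly_pmap_line: "poly (pmap_line g h b) s = pmap (th_scale s g + h) b"
  by (simp add: pmap_line_def pmap_def poly_sum line_def th_scale_def algebra_simps)

lemma line_power_top:
  "degree (line g h b ^ N) \<le> N" "coeff (line g h b ^ N) N = g b ^ N"
proof (induction N)
  case (Suc N)
  {
    case 1
    have "degree (line g h b ^ Suc N) \<le> degree (line g h b) + degree (line g h b ^ N)"
      by (simp add: degree_mult_le)
    also have "\<dots> \<le> 1 + N" using Suc(1) by (intro add_mono) (auto simp: line_def)
    finally show ?case by simp
  next
    case 2
    have "degree (line g h b) \<le> 1" by (simp add: line_def)
    from coeff_mult_top[OF this Suc(1)] show ?case using Suc(2) by (simp add: line_def)
  }
qed simp_all

lemma pmap_line_top:
  "degree (pmap_line g h b) \<le> 2*r+3" "coeff (pmap_line g h b) (2*r+3) = pmap g b"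
proof -
  \<comment> \<open>At \<open>z\<close> the degree \<open>p\<close> splits as \<open>p-2\<close>
    linear factors times a quadratic sum, elsewhere as \<open>p-1\<close> factors times one
    more.\<close>
  have eq: "2*r+3 = (2*r+1)+2" "2*r+3 = (2*r+2)+1" by simp_all
  let ?S = "\<Sum>a\<in>V. smult (\<epsilon> a * \<mu> a ^ (2*r+1)) (line g h a ^ 2)"
  have S: "degree ?S \<le> 2"
    using finite_VWH by (intro degree_sum_le)
      (auto intro: order.trans[OF degree_smult_le] line_power_top)
  have L: "degree (line g h b) \<le> 1" by (simp add: line_def)
  have 1: "degree (line g h d ^ (2*r+1) * ?S) \<le> 2*r+3"
    unfolding eq(1) by (intro order.trans[OF degree_mult_le] add_mono line_power_top S)
  have 2: "degree (line g h d ^ (2*r+2) * line g h b) \<le> 2*r+3"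
    unfolding eq(2) by (intro order.trans[OF degree_mult_le] add_mono line_power_top L)
  show "degree (pmap_line g h b) \<le> 2*r+3"
    unfolding pmap_line_def using 1 2 by (auto intro: order.trans[OF degree_smult_le])
  have 3: "coeff (line g h d ^ (2*r+1) * ?S) (2*r+3) =
      g d ^ (2*r+1) * (\<Sum>a\<in>V. \<epsilon> a * \<mu> a ^ (2*r+1) * g a ^ 2)"
    unfolding eq(1) coeff_mult_top[OF line_power_top(1) S] line_power_top(2)
    by (simp only: coeff_sum coeff_smult line_power_top(2))
  have 4: "coeff (line g h d ^ (2*r+2) * line g h b) (2*r+3) = g d ^ (2*r+2) * g b"
    unfolding eq(2) coeff_mult_top[OF line_power_top(1) L] line_power_top(2)
    by (simp add: line_def)
  show "coeff (pmap_line g h b) (2*r+3) = pmap g b"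
    using 3 4 by (simp add: pmap_line_def pmap_def del: power_Suc)
qed

lemma of_nat_char: "(of_nat (2*r+3) :: 'f) = 0"
  using of_nat_CHAR[where ?'a='f] by (simp add: char_odd)

lemma pderiv_line: "pderiv (line g h b) = [:g b:]"
  by (simp add: line_def pderiv_pCons)

lemma pderiv_line_power:
  "pderiv (line g h b ^ Suc N) = of_nat (Suc N) * line g h b ^ N * [:g b:]"
  unfolding pderiv_power_Suc pderiv_line by (simp add: of_nat_poly)

text \<open>Let \<open>A\<close> be the \<open>d\<close>-coordinate of the line and \<open>K\<close>
  another one. Since \<open>p-1 = -1\<close> in the field, \<open>A^(p-1) K\<close> has derivative
  \<open>A^(p-2) (A K' - K A')\<close>. Since \<open>p-2 = -2\<close>, \<open>A^(p-2) K^2\<close>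
  has derivative \<open>2 A^(p-3) K (A K' - K A')\<close>, and the factor 1/2 in
  \<open>pmap_line\<close> removes the 2. These are the closed forms for the even power
  \<open>p-1\<close>.\<close>

lemma coords_ad_poly_pmap:
  assumes g: "g \<in> space 0" and h: "h \<in> space 0"
  shows "coords ((ad_poly tbr g h ^^ (2*r+2)) [:g:]) b = pderiv (pmap_line g h b)"
proof (cases "b = z")
  case False
  let ?A = "line g h d"
  have n: "(of_nat (2*r+2) :: 'f poly) = - 1"
  proof -
    have "(of_nat (2*r+2) :: 'f) = - 1"
      using of_nat_char by (simp add: algebra_simps eq_neg_iff_add_eq_0)
    then show ?thesis by (metis of_nat_poly one_pCons minus_pCons minus_zero)
  qed
  have "coords ((ad_poly tbr g h ^^ (2*r+2)) [:g:]) b =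
      [:\<mu> b:] ^ (2*r+2) * ?A ^ (2*r+1) * (?A * [:g b:] - line g h b * [:g d:])"
    unfolding coords_ad_poly_funpow using False by (rule poly.funpow_tbr_even)
  also have "\<dots> = [:c:] * ?A ^ (2*r+1) * (?A * [:g b:] - line g h b * [:g d:])"
  proof (cases "b \<in> V")
    case True
    then have "[:\<mu> b:] ^ (2*r+2) = [:c:]" using wt_power[of b] by (simp only: poly_const_pow UnI1)
    then show ?thesis by simp
  next
    case out: False
    \<comment> \<open>Off \<open>V\<close> the weight need not have power \<open>c\<close>, but the
      last factor is 0: for \<open>b = d\<close> its terms cancel, otherwise \<open>g\<close> and
      \<open>h\<close> vanish at \<open>b\<close>.\<close>
    have "?A * [:g b:] - line g h b * [:g d:] = 0"
    proof (cases "b = d")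
      case False
      then have "g b = 0" "h b = 0" using out \<open>b \<noteq> z\<close> g h by (auto simp: space_0)
      then show ?thesis by (simp add: line_def)
    qed simp
    then show ?thesis by simp
  qed
  also have "\<dots> = pderiv (smult c (?A ^ (2*r+2) * line g h b))"
  proof -
    have "2*r+2 = Suc (2*r+1)" by simp
    then have "pderiv (?A ^ (2*r+2)) = of_nat (2*r+2) * ?A ^ (2*r+1) * [:g d:]"
      using pderiv_line_power[of g h d "2*r+1"] by (simp only:)
    then show ?thesis
      unfolding pderiv_smult pderiv_mult pderiv_line n by (simp add: algebra_simps)
  qed
  finally show ?thesis using False by (simp add: pmap_line_def)
next
  case True
  let ?A = "line g h d" and ?k = "line g h" and ?e = "\<lambda>a. \<epsilon> a * \<mu> a ^ (2*r+1)"
  let ?S = "\<Sum>a\<in>V. smult (?e a) (?k a ^ 2)"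
  have n: "(of_nat (2*r+1) :: 'f poly) = - 2"
  proof -
    have "(of_nat (2*r+1) :: 'f) = - 2"
      using of_nat_char by (simp add: algebra_simps eq_neg_iff_add_eq_0)
    then show ?thesis
      by (metis of_nat_poly minus_pCons minus_zero numeral_poly)
  qed
  have alg: "A ^ (2*r+1) * smult c (2 * (K * G)) + smult c (K ^ 2) * (- 2 * A ^ (2*r) * D) =
      2 * smult c (A ^ (2*r) * K * (A * G - K * D))" for A K G D :: "'f poly" and c
  proof -
    have "A ^ (2*r+1) * (C * (2 * (K * G))) + C * K ^ 2 * (- 2 * A ^ (2*r) * D) =
      2 * (C * (A ^ (2*r) * K * (A * G - K * D)))" for C
      by (simp add: algebra_simps power2_eq_square)
    from this[of "[:c:]"] show ?thesis by simp
  qed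
  have half: "smult (inverse 2) (2 * X) = X" for X :: "'f poly"
    using two_neq_0 by (simp add: numeral_poly)
  have odd: "line g h b = 0" if "b \<in> W \<union> H" for b
    using space_0_odd[of g b] space_0_odd[of h b] g h that by (simp add: line_def)
  have "2*r+1 = Suc (2*r)" by simp
  then have "pderiv (?A ^ (2*r+1)) = of_nat (2*r+1) * ?A ^ (2*r) * [:g d:]"
    using pderiv_line_power[of g h d "2*r"] by (simp only:)
  then have "pderiv (?A ^ (2*r+1)) = - 2 * ?A ^ (2*r) * [:g d:]"
    by (simp only: n)
  moreover have "pderiv ?S = (\<Sum>a\<in>V. smult (?e a) (2 * (?k a * [:g a:])))"
  proof -
    have "pderiv (?k a ^ 2) = 2 * (?k a * [:g a:])" for a
      by (simp only: power2_eq_square pderiv_mult pderiv_line mult_2)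
    then show ?thesis
      using higher_pderiv_sum[of "Suc 0" "\<lambda>a. smult (?e a) (?k a ^ 2)" V]
      by (simp only: funpow.simps comp_apply id_apply pderiv_smult)
  qed
  ultimately have "pderiv (pmap_line g h z) = smult (inverse 2)
      (?A ^ (2*r+1) * (\<Sum>a\<in>V. smult (?e a) (2 * (?k a * [:g a:]))) + ?S * (- 2 * ?A ^ (2*r) * [:g d:]))"
    by (simp only: pmap_line_def pderiv_smult pderiv_mult if_True refl)
  also have "\<dots> = smult (inverse 2)
      (2 * (\<Sum>a\<in>V. smult (?e a) (?A ^ (2*r) * ?k a * (?A * [:g a:] - ?k a * [:g d:]))))"
    unfolding sum_distrib_left sum_distrib_right sum.distrib[symmetric]
    by (intro arg_cong2[where f=smult] sum.cong refl alg)
  also have "\<dots> = (\<Sum>a\<in>V. smult (?e a) (?A ^ (2*r) * ?k a * (?A * [:g a:] - ?k a * [:g d:])))"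
    by (rule half)
  also have "\<dots> = (\<Sum>a\<in>V. [:\<epsilon> a:] * ?k a *
      ([:\<mu> a:] ^ (2*r+1) * ?A ^ (2*r) * (?A * [:g a:] - ?k a * [:g d:])))"
    unfolding poly_const_pow by (intro sum.cong) (simp_all add: mult_ac)
  also have "\<dots> = coords ((ad_poly tbr g h ^^ (2*r+2)) [:g:]) z"
    unfolding coords_ad_poly_funpow using odd by (rule poly.funpow_tbr_even_z[symmetric])
  finally show ?thesis using True by simp
qed

text \<open>Division by \<open>i\<close>, invertible below \<open>p\<close>, undoes the
  differentiation: \<open>jacobson_s\<close> at \<open>i\<close> is the
  \<open>T^i\<close>-coefficient of \<open>pmap_line\<close>. The remaining coefficients, 0 and
  \<open>p\<close>, are \<open>pmap h\<close> and \<open>pmap g\<close>.\<close>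

lemma pmap_add:
  assumes "g \<in> space 0" "h \<in> space 0"
  shows "pmap (g + h) = pmap g + pmap h + (\<Sum>i = 1..CHAR('f) - 1. jacobson_s th_scale tbr i g h)"
proof
  fix b
  let ?P = "pmap_line g h b"
  have "(\<Sum>i = 1..CHAR('f) - 1. jacobson_s th_scale tbr i g h) b =
    (\<Sum>i = 1..CHAR('f) - 1. jacobson_s th_scale tbr i g h b)"
    by (rule sum_fun_apply)
  also have "\<dots> = (\<Sum>i = 1..2*r+2. coeff ?P i)"
  proof (rule sum.cong)
    fix i assume i: "i \<in> {1..2*r+2}"
    then have i0: "(of_nat i :: 'f) \<noteq> 0"
      by (auto simp: of_nat_eq_0_iff_char_dvd char_odd dest: dvd_imp_le)
    have "coeff ((ad_poly tbr g h ^^ (2*r+2)) [:g:]) (i - 1) b = of_nat i * coeff ?P i"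
      unfolding coeff_coords[symmetric] coords_ad_poly_pmap[OF assms]
      using i by (simp add: coeff_pderiv)
    then show "jacobson_s th_scale tbr i g h b = coeff ?P i"
      using i0 by (simp add: jacobson_s_def th_scale_def char_odd)
  qed (simp add: char_odd)
  also have "\<dots> = (\<Sum>i\<le>2*r+3. coeff ?P i) - coeff ?P 0 - coeff ?P (2*r+3)"
  proof -
    have "{..2*r+3} = insert 0 (insert (2*r+3) {1..2*r+2})" by auto
    then show ?thesis by simp
  qed
  also have "(\<Sum>i\<le>2*r+3. coeff ?P i) = poly ?P 1"
    unfolding poly_altdef using pmap_line_top(1)[of g h b]
    by (simp, intro sum.mono_neutral_right) (auto intro: coeff_eq_0)
  also have "poly ?P 1 = pmap (g + h) b"
    unfolding poly_pmap_line by (simp add: th_scale_def plus_fun_def)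
  also have "coeff ?P 0 = pmap h b"
    using poly_pmap_line[of g h b 0] by (simp add: th_scale_def poly_0_coeff_0 zero_fun_def[symmetric])
  also have "coeff ?P (2*r+3) = pmap g b" by (rule pmap_line_top)
  finally show "pmap (g + h) b =
    (pmap g + pmap h + (\<Sum>i = 1..CHAR('f) - 1. jacobson_s th_scale tbr i g h)) b"
    by (simp add: plus_fun_def)
qed

lemma restricted: "restricted_lie_superalgebra th_scale space tbr pmap"
proof -
  interpret lie_superalgebra th_scale space tbr by (rule lie_superalgebra)
  have jac: "tbr (tbr x y) v = tbr x (tbr y v) - tbr y (tbr x v)"
    if "x \<in> space 0" "y \<in> space 0" "v \<in> space a" for x y v a
    using super_jacobi[OF that] by (simp add: super_sign_def)
  have skew: "tbr x y = - tbr y x" if "x \<in> space 0" "y \<in> space 0" for x y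
    using super_skew[OF that] by (simp add: super_sign_def)
  show ?thesis
  proof unfold_locales
    \<comment> \<open>Skew-symmetry on the even part converts the derivation form of the Jacobi
      identity into the cyclic one.\<close>
    fix x y w assume *: "x \<in> space 0" "y \<in> space 0" "w \<in> space 0"
    then have cl: "tbr x y \<in> space 0" using super_br_closed[of x 0 y 0] by simp
    have "tbr y (tbr w x) = - tbr y (tbr x w)"
      unfolding skew[OF *(3,1)] by (metis add_neg_numeral_special(7) tbr_scale_right scale_minus_left scale_one)
    then show "tbr x (tbr y w) + tbr y (tbr w x) + tbr w (tbr x y) = 0"
      using jac[OF *] skew[OF *(3) cl] by simp
  qed (use funpow_char_tbr tbr_closed[of _ 0 _ 0] tbr_closed[of _ 0 _ 1] in
     \<open>simp_all add: subspace_space bilinear_tbr tbr_self pmap_closed pmap_scale pmap_add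
       jac char_odd\<close>)
qed

end

section \<open>Necessity of the weight condition\<close>

context twisted_field
begin

text \<open>The \<open>p\<close>-th power of \<open>ad d\<close> is known on \<open>V\<close> from
  the algebra axiom and on \<open>W\<close> from the module axiom. Applied to
  \<open>th_unit e\<close>, it is compared in coordinate \<open>e\<close> when \<open>p = 2\<close>
  and in coordinate \<open>\<tau> e\<close> when \<open>p\<close> is odd.\<close>

lemma restricted_weights:
  assumes "restricted_lie_superalgebra th_scale space tbr pm"
    and e: "e \<in> V \<union> W" and wt: "\<mu> e \<noteq> 0" and fixfree: "\<tau> e \<noteq> e"
  shows "CHAR('f) \<noteq> 2"
    and "odd CHAR('f) \<Longrightarrow> \<mu> e ^ (CHAR('f) - 1) = pm (th_unit d) d"
proof -
  interpret restricted_lie_superalgebra th_scale space tbr pm by fact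
  have ud: "th_unit d \<in> space 0" by (auto simp: space_0 th_unit_def)
  have "th_unit e \<in> space 0 \<or> th_unit e \<in> space 1"
    using e by (auto simp: space_0 space_1 th_unit_def)
  then have pow: "(tbr (th_unit d) ^^ CHAR('f)) (th_unit e) = tbr (pm (th_unit d)) (th_unit e)"
    using ud even.ad_pmap odd.act_pmap by blast
  have ne: "e \<noteq> d" "e \<noteq> z" "\<tau> e \<noteq> z" using VW_ne swap_VW e by blast+
  show "CHAR('f) \<noteq> 2"
  proof
    assume "CHAR('f) = 2"
    then have "(tbr (th_unit d) ^^ (2*0+2)) (th_unit e) e = tbr (pm (th_unit d)) (th_unit e) e"
      using fun_cong[OF pow, of e] by (simp only: mult_0_right add_0)
    then have "\<mu> e ^ 2 = 0"
      unfolding funpow_tbr_even[OF ne(2)] tbr_not_z[OF ne(2)]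
      using ne fixfree by (simp add: th_unit_def)
    then show False using wt by simp
  qed
  assume "odd CHAR('f)"
  then obtain k where k: "CHAR('f) = 2*k+1" by (elim oddE)
  have "(tbr (th_unit d) ^^ (2*k+1)) (th_unit e) (\<tau> e) = tbr (pm (th_unit d)) (th_unit e) (\<tau> e)"
    using fun_cong[OF pow, of "\<tau> e"] unfolding k .
  then have "\<mu> e ^ (2*k+1) = \<mu> e * pm (th_unit d) d"
    unfolding funpow_tbr_odd[OF ne(3)] tbr_not_z[OF ne(3)]
    using ne e by (simp add: th_unit_def swap_swap wt_swap)
  then show "\<mu> e ^ (CHAR('f) - 1) = pm (th_unit d) d"
    using wt k by simp
qed

end

section \<open>The twisted Heisenberg Lie superalgebra\<close>

text \<open>Outside the paired indices the values are mere defaults, which \<open>th_wt\<close>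
  multiplies by 0 in the bracket.\<close>

definition th_swap :: "nat \<Rightarrow> nat \<Rightarrow> th_index \<Rightarrow> th_index" where
  "th_swap m n b = (case b of
      Ev i \<Rightarrow> Ev (if i \<le> m then m + i else i - m)
    | Om j \<Rightarrow> Om (if j \<le> n then n + j else j - n)
    | Et k \<Rightarrow> Et k)"

definition th_sign :: "nat \<Rightarrow> nat \<Rightarrow> th_index \<Rightarrow> 'f::field" where
  "th_sign m n b = (case b of
      Ev i \<Rightarrow> if i \<le> m then 1 else - 1
    | Om j \<Rightarrow> if j \<le> n then 1 else - 1
    | Et k \<Rightarrow> 1)"

definition th_wt :: "nat \<Rightarrow> nat \<Rightarrow> (nat \<Rightarrow> 'f::field) \<Rightarrow> (nat \<Rightarrow> 'f) \<Rightarrow> th_index \<Rightarrow> 'f" where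
  "th_wt m n lam kap b = (case b of
      Ev i \<Rightarrow> if i \<in> {1..m} then lam i else if i \<in> {m+1..2*m} then lam (i - m) else 0
    | Om j \<Rightarrow> if j \<in> {1..n} then kap j else if j \<in> {n+1..2*n} then kap (j - n) else 0
    | Et k \<Rightarrow> 0)"

text \<open>The matrix of \<open>ad d\<close>, read by source index \<open>j\<close> as in
  \<open>th_basis_br\<close> and by target index \<open>k\<close> as in \<open>tbr\<close>; the
  weight is the same on both indices of a pair.\<close>

lemma swap_coefficient:
  fixes M j k :: nat and f :: "nat \<Rightarrow> 'f::field"
  assumes "1 \<le> j"
  shows "(if j \<in> {1..M} then f j * (if k = M + j then 1 else 0)
      else if j \<in> {M+1..2*M} then f (j - M) * (if k = j - M then 1 else 0) else 0) =
    (if k \<in> {1..M} then f k else if k \<in> {M+1..2*M} then f (k - M) else 0) *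
      (if j = (if k \<le> M then M + k else k - M) then 1 else 0)"
proof -
  consider "k = 0" | "k \<in> {1..M}" | "k \<in> {M+1..2*M}" | "k > 2*M" by force
  then show ?thesis using assms by cases auto
qed

locale twisted_heisenberg =
  fixes m n t :: nat and lam kap :: "nat \<Rightarrow> 'f::field"
begin

sublocale twisted_field "Ev ` {1..2*m}" "Om ` {1..2*n}" "Et ` {1..t}" "Ev (2*m+2)" "Ev (2*m+1)"
    "th_swap m n" "th_sign m n" "th_wt m n lam kap"
proof unfold_locales
  fix b assume "b \<notin> Ev ` {1..2*m} \<union> Om ` {1..2*n}"
  then show "th_wt m n lam kap b = 0"
    by (cases b) (auto simp: th_wt_def image_iff)
qed (auto simp: th_swap_def th_sign_def th_wt_def intro!: imageI, arith+)

abbreviation I :: "th_index set" where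
  "I \<equiv> th_indices m n t 0 \<union> th_indices m n t 1"

lemma I_eq: "I = Ev ` {1..2*m} \<union> {Ev (2*m+1), Ev (2*m+2)} \<union> Om ` {1..2*n} \<union> Et ` {1..t}"
proof -
  have "{1..2*m+2} = {1..2*m} \<union> {2*m+1, 2*m+2}" by auto
  then show ?thesis by (simp add: th_indices_def image_Un Un_assoc)
qed

lemma th_space_eq: "th_space m n t = space"
proof (rule ext)
  fix a
  have "{1..2*m+2} = {1..2*m} \<union> {2*m+2, 2*m+1}" by auto
  then have "Ev ` {1..2*m+2} = Ev ` {1..2*m} \<union> {Ev (2*m+2), Ev (2*m+1)}"
    by (simp only: image_Un image_insert image_empty)
  then show "th_space m n t a = space a"
    by (simp only: th_space_def space_def th_indices_def)
qed

section \<open>Comparison of the basis brackets with the coordinate formula\<close>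

lemma in_I: "Ev i \<in> I \<longleftrightarrow> 1 \<le> i \<and> i \<le> 2*m+2" "Om j \<in> I \<longleftrightarrow> 1 \<le> j \<and> j \<le> 2*n"
    "Et k \<in> I \<longleftrightarrow> 1 \<le> k \<and> k \<le> t"
  by (auto simp: th_indices_def)

lemma th_basis_br_z:
  assumes "b \<in> I" "c \<in> I"
  shows "th_basis_br m n lam kap b c (Ev (2*m+1)) =
    (if b \<in> Ev ` {1..2*m} then (if c = th_swap m n b then th_sign m n b else 0)
     else if b \<in> Om ` {1..2*n} \<union> Et ` {1..t} then (if c = b then th_sign m n b else 0)
     else 0)"
proof (cases b)
  case b: (Ev i)
  show ?thesis
  proof (cases c)
    case c: (Ev j)
    have ij: "1 \<le> i" "1 \<le> j" using assms unfolding b c in_I by simp_all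
    consider "i \<le> m" | "m < i" "i \<le> 2*m" | "2*m < i" by linarith
    then show ?thesis
      using ij unfolding b c
      by cases (auto simp: th_swap_def th_sign_def th_unit_def th_scale_def)
  qed (auto simp: b th_swap_def th_unit_def th_scale_def)
next
  case b: (Om i)
  have "1 \<le> i \<and> i \<le> 2*n" using assms(1) unfolding b in_I .
  then show ?thesis
    unfolding b by (cases c) (auto simp: th_sign_def th_unit_def th_scale_def)
next
  case b: (Et i)
  have "1 \<le> i \<and> i \<le> t" using assms(1) unfolding b in_I .
  then show ?thesis
    unfolding b by (cases c) (auto simp: th_sign_def th_unit_def th_scale_def)
qed

text \<open>Reduces brackets with \<open>e_{2m+2}\<close> in second place to those with it in first
  place.\<close>

lemma th_basis_br_skew:
  assumes "b = Ev i" "b \<noteq> c"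
  shows "th_basis_br m n lam kap c b = - th_basis_br m n lam kap b c"
  using assms by (cases c) (auto simp: th_scale_def)

lemma th_basis_br_d:
  assumes "c \<in> I" "e \<noteq> Ev (2*m+1)"
  shows "th_basis_br m n lam kap (Ev (2*m+2)) c e =
    th_wt m n lam kap e * (if c \<noteq> Ev (2*m+2) \<and> c = th_swap m n e then 1 else 0)"
proof (cases c)
  case c: (Ev j)
  have j: "1 \<le> j" using assms unfolding c in_I by simp
  show ?thesis
  proof (cases e)
    case e: (Ev k)
    have "th_basis_br m n lam kap (Ev (2*m+2)) c e =
      (if j \<in> {1..m} then lam j * (if k = m + j then 1 else 0)
       else if j \<in> {m+1..2*m} then lam (j - m) * (if k = j - m then 1 else 0) else 0)"
      unfolding c e using assms j by (auto simp: th_unit_def th_scale_def)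
    also note swap_coefficient[OF j]
    finally show ?thesis unfolding c e th_wt_def th_swap_def by auto
  qed (auto simp: c th_swap_def th_unit_def th_scale_def)
next
  case c: (Om j)
  have j: "1 \<le> j" using assms unfolding c in_I by simp
  show ?thesis
  proof (cases e)
    case e: (Om k)
    have "th_basis_br m n lam kap (Ev (2*m+2)) c e =
      (if j \<in> {1..n} then kap j * (if k = n + j then 1 else 0)
       else if j \<in> {n+1..2*n} then kap (j - n) * (if k = j - n then 1 else 0) else 0)"
      unfolding c e by (simp add: th_unit_def th_scale_def)
    also note swap_coefficient[OF j]
    finally show ?thesis unfolding c e th_wt_def th_swap_def by simp
  qed (auto simp: c th_swap_def th_unit_def th_scale_def)
next
  case (Et j)
  then show ?thesis by (cases e) (auto simp: th_wt_def th_swap_def)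
qed

lemma th_basis_br_not_z:
  assumes "b \<in> I" "c \<in> I" "e \<noteq> Ev (2*m+1)"
  shows "th_basis_br m n lam kap b c e = th_wt m n lam kap e *
    ((if b = Ev (2*m+2) then (if c = th_swap m n e then 1 else 0) else 0)
      - (if c = Ev (2*m+2) then (if b = th_swap m n e then 1 else 0) else 0))"
proof -
  consider "b = Ev (2*m+2)" | "b \<noteq> Ev (2*m+2)" "c = Ev (2*m+2)"
    | "b \<noteq> Ev (2*m+2)" "c \<noteq> Ev (2*m+2)" by blast
  then show ?thesis
  proof cases
    case 1
    show ?thesis unfolding 1 th_basis_br_d[OF assms(2,3)] by simp
  next
    case 2
    then show ?thesis
      using th_basis_br_skew[OF 2(2)] th_basis_br_d[OF assms(1,3)] by auto
  next
    case 3
    then show ?thesis using assms(3)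
      by (cases b; cases c) (simp_all add: th_unit_def)
  qed
qed

text \<open>At \<open>z\<close> each basis vector pairs with at most one other; at other coordinates
  only terms with \<open>d\<close> as an argument survive. Either way the double sum
  collapses.\<close>

lemma th_br_eq: "th_br m n t lam kap = tbr"
proof (intro ext)
  fix x y e
  have fin: "finite I" by (simp add: th_indices_def)
  have br: "th_br m n t lam kap x y e = (\<Sum>b\<in>I. \<Sum>c\<in>I. x b * y c * th_basis_br m n lam kap b c e)"
    by (simp add: th_br_def sum_fun_apply th_scale_def)
  show "th_br m n t lam kap x y e = tbr x y e"
  proof (cases "e = Ev (2*m+1)")
    case True
    let ?V = "Ev ` {1..2*m}" and ?W = "Om ` {1..2*n} \<union> Et ` {1..t}"
    have "(\<Sum>c\<in>I. x b * y c * th_basis_br m n lam kap b c e) =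
        (if b \<in> ?V then th_sign m n b * x b * y (th_swap m n b) else 0) +
        (if b \<in> ?W then th_sign m n b * x b * y b else 0)" if b: "b \<in> I" for b
    proof -
      consider "b \<in> ?V" "b \<notin> ?W" | "b \<in> ?W" "b \<notin> ?V" | "b \<notin> ?V" "b \<notin> ?W"
        by blast
      then show ?thesis
      proof cases
        case 1
        then have "th_swap m n b \<in> I" using swap_V unfolding I_eq by blast
        moreover have "(\<Sum>c\<in>I. x b * y c * th_basis_br m n lam kap b c e) =
            (\<Sum>c\<in>I. if c = th_swap m n b then x b * y c * th_sign m n b else 0)"
          using 1 b True th_basis_br_z by (intro sum.cong) simp_all
        ultimately show ?thesis using 1 fin by (simp add: sum.delta mult_ac)
      next
        case 2
        have "(\<Sum>c\<in>I. x b * y c * th_basis_br m n lam kap b c e) =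
            (\<Sum>c\<in>I. if c = b then x b * y c * th_sign m n b else 0)"
          using 2 b True th_basis_br_z by (intro sum.cong) simp_all
        then show ?thesis using 2 b fin by (simp add: sum.delta mult_ac)
      next
        case 3
        have "(\<Sum>c\<in>I. x b * y c * th_basis_br m n lam kap b c e) = 0"
          using 3 b True th_basis_br_z by (intro sum.neutral) simp
        then show ?thesis using 3 by simp
      qed
    qed
    then have "th_br m n t lam kap x y e =
        (\<Sum>b\<in>I. if b \<in> ?V then th_sign m n b * x b * y (th_swap m n b) else 0) +
        (\<Sum>b\<in>I. if b \<in> ?W then th_sign m n b * x b * y b else 0)"
      unfolding br sum.distrib[symmetric] by (intro sum.cong) simp_all
    also have "\<dots> = (\<Sum>b\<in>I \<inter> ?V. th_sign m n b * x b * y (th_swap m n b)) +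
        (\<Sum>b\<in>I \<inter> ?W. th_sign m n b * x b * y b)"
      using fin by (simp only: sum.inter_restrict)
    also have "I \<inter> ?V = ?V" unfolding I_eq by blast
    also have "I \<inter> ?W = ?W" unfolding I_eq by blast
    finally show ?thesis using True by (simp only: tbr_z)
  next
    case False
    let ?d = "Ev (2*m+2)" and ?s = "th_swap m n e" and ?w = "th_wt m n lam kap e"
    have d: "?d \<in> I" unfolding I_eq by blast
    have "th_br m n t lam kap x y e =
      (\<Sum>b\<in>I. \<Sum>c\<in>I. (if b = ?d then (if c = ?s then ?w * (x b * y c) else 0) else 0)
        - (if c = ?d then (if b = ?s then ?w * (x b * y c) else 0) else 0))"
      unfolding br
    proof (intro sum.cong[OF refl])
      fix b c assume "b \<in> I" "c \<in> I"
      from th_basis_br_not_z[OF this False]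
      show "x b * y c * th_basis_br m n lam kap b c e =
        (if b = ?d then (if c = ?s then ?w * (x b * y c) else 0) else 0)
        - (if c = ?d then (if b = ?s then ?w * (x b * y c) else 0) else 0)"
        by (simp only:) (auto simp: algebra_simps)
    qed
    also have "\<dots> = (\<Sum>b\<in>I. if b = ?d then (\<Sum>c\<in>I. if c = ?s then ?w * (x b * y c) else 0) else 0) -
        (\<Sum>b\<in>I. if b = ?s then ?w * (x b * y ?d) else 0)"
      unfolding sum_subtractf using fin d
      by (intro arg_cong2[where f=minus] sum.cong) (simp_all add: sum.delta)
    also have "\<dots> = (if ?s \<in> I then ?w * (x ?d * y ?s - x ?s * y ?d) else 0)"
      using fin d by (simp add: sum.delta algebra_simps)
    also have "\<dots> = tbr x y e"
    \<comment> \<open>For \<open>e\<close> in a pair, \<open>?s\<close> lies in \<open>I\<close>;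
      otherwise the weight is 0, so the conditional disappears in both cases.\<close>
    proof (cases "e \<in> Ev ` {1..2*m} \<union> Om ` {1..2*n}")
      case True
      then have "?s \<in> I" using swap_VW unfolding I_eq by blast
      then show ?thesis unfolding tbr_not_z[OF False] by simp
    next
      case out: False
      then have "?w = 0" by (rule wt_0)
      then show ?thesis using tbr_not_z[OF False] by simp
    qed
    finally show ?thesis .
  qed
qed

end

section \<open>The criterion for restrictedness\<close>

theorem theorem2p3:
  fixes m n t p :: nat
    and lam kap :: "nat \<Rightarrow> 'f::alg_closed_field"
  assumes "CHAR('f) = p" and "p > 0"
    and "m \<ge> 1" and "n \<ge> 1" and "t \<ge> 1"
    and "\<forall>i\<in>{1..m}. lam i \<noteq> 0" and "\<forall>j\<in>{1..n}. kap j \<noteq> 0"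
  shows "admits_restriction th_scale (th_space m n t) (th_br m n t lam kap) \<longleftrightarrow>
    p > 2 \<and> (\<forall>i\<in>{1..m}. lam i ^ (p - 1) = lam 1 ^ (p - 1)) \<and>
    (\<forall>j\<in>{1..n}. kap j ^ (p - 1) = lam 1 ^ (p - 1))"
proof
  interpret twisted_heisenberg m n t lam kap .
  let ?wt = "th_wt m n lam kap"
  have p: "prime p" using prime_CHAR_semidom[where ?'a='f] assms(1,2) by simp
  {
    assume "admits_restriction th_scale (th_space m n t) (th_br m n t lam kap)"
    then obtain pm where pm: "restricted_lie_superalgebra th_scale space tbr pm"
      unfolding admits_restriction_def th_space_eq th_br_eq by blast
    have ev: "?wt (Ev i) = lam i" "?wt (Ev i) \<noteq> 0" "Ev i \<in> Ev ` {1..2*m} \<union> Om ` {1..2*n}"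
      "th_swap m n (Ev i) \<noteq> Ev i" if "i \<in> {1..m}" for i
      using that assms by (auto simp: th_wt_def th_swap_def)
    have om: "?wt (Om j) = kap j" "?wt (Om j) \<noteq> 0" "Om j \<in> Ev ` {1..2*m} \<union> Om ` {1..2*n}"
      "th_swap m n (Om j) \<noteq> Om j" if "j \<in> {1..n}" for j
      using that assms by (auto simp: th_wt_def th_swap_def)
    have "1 \<in> {1..m}" using assms by simp
    note one = ev[OF this]
    have p2: "p \<noteq> 2" using restricted_weights(1)[OF pm one(3,2,4)] assms(1) by simp
    then have "p > 2" using prime_ge_2_nat[OF p] by simp
    then have "odd p" using p prime_odd_nat by blast
    \<comment> \<open>The right-hand side is independent of \<open>e\<close>, which forces all the
      powers to agree.\<close>
    then have pw: "?wt e ^ (p - 1) = pm (th_unit (Ev (2*m+2))) (Ev (2*m+2))"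
      if "e \<in> Ev ` {1..2*m} \<union> Om ` {1..2*n}" "?wt e \<noteq> 0" "th_swap m n e \<noteq> e" for e
      using restricted_weights(2)[OF pm that] assms(1) by simp
    show "p > 2 \<and> (\<forall>i\<in>{1..m}. lam i ^ (p - 1) = lam 1 ^ (p - 1)) \<and>
      (\<forall>j\<in>{1..n}. kap j ^ (p - 1) = lam 1 ^ (p - 1))"
      using \<open>p > 2\<close> pw ev om one by metis
  }
  assume *: "p > 2 \<and> (\<forall>i\<in>{1..m}. lam i ^ (p - 1) = lam 1 ^ (p - 1)) \<and>
    (\<forall>j\<in>{1..n}. kap j ^ (p - 1) = lam 1 ^ (p - 1))"
  then have "odd p" using p prime_odd_nat by blast
  then obtain q where q: "p = 2*q+1" by (elim oddE)
  have lam: "lam i ^ (p - 1) = lam 1 ^ (p - 1)" if "i \<in> {1..m}" for i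
    using * that by blast
  have kap: "kap j ^ (p - 1) = lam 1 ^ (p - 1)" if "j \<in> {1..n}" for j
    using * that by blast
  \<comment> \<open>Since \<open>p > 2\<close> gives \<open>q \<ge> 1\<close>, the subtraction is
    exact.\<close>
  define r where "r = q - 1"
  have r: "p = 2*r+3" using q conjunct1[OF *] unfolding r_def by arith
  \<comment> \<open>The common value \<open>c\<close> is taken from \<open>lam 1\<close>; the
    hypothesis transfers it to all other weights.\<close>
  interpret twisted_restricted "Ev ` {1..2*m}" "Om ` {1..2*n}" "Et ` {1..t}" "Ev (2*m+2)" "Ev (2*m+1)"
    "th_swap m n" "th_sign m n" ?wt r "lam 1 ^ (p - 1)"
  proof unfold_locales
    show "CHAR('f) = 2*r+3" using assms(1) r by simp
    fix b assume b: "b \<in> Ev ` {1..2*m} \<union> Om ` {1..2*n}"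
    have "?wt b ^ (p - 1) = lam 1 ^ (p - 1)"
    proof (cases b)
      case (Ev i)
      then have i: "1 \<le> i" "i \<le> 2*m" using b by auto
      then have "(if i \<le> m then i else i - m) \<in> {1..m}" by auto
      moreover have "?wt b = lam (if i \<le> m then i else i - m)"
        using i by (auto simp: Ev th_wt_def)
      ultimately show ?thesis by (simp only: lam)
    next
      case (Om j)
      then have j: "1 \<le> j" "j \<le> 2*n" using b by auto
      then have "(if j \<le> n then j else j - n) \<in> {1..n}" by auto
      moreover have "?wt b = kap (if j \<le> n then j else j - n)"
        using j by (auto simp: Om th_wt_def)
      ultimately show ?thesis by (simp only: kap)
    qed (use b in auto)
    then show "?wt b ^ (2*r+2) = lam 1 ^ (p - 1)" using r by simp
  qed
  show "admits_restriction th_scale (th_space m n t) (th_br m n t lam kap)"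
    unfolding admits_restriction_def th_space_eq th_br_eq using restricted by blast
qed

end
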